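(* Let $\Omega$ be a semigroup and let $(D,\{\theta_k\}_{k\geq1})$ be a Dend$_\infty$-family algebra over a field ${\bf k}$ of characteristic $0$. (i) $(D\otimes{\bf k}\Omega,\{\overline\theta_k\}_{k\geq1})$ is a Dend$_\infty$-algebra, where $$(\overline\theta_k)^{[r]}\big(x_1\otimes\alpha_1,\ldots,x_k\otimes\alpha_k\big):=(\theta_k)^{[r]}_{\alpha_1,\ldots,\alpha_k}(x_1,\ldots,x_k)\otimes\alpha_1\cdots\alpha_k,$$ for $x_1\otimes\alpha_1,\ldots,x_k\otimes\alpha_k\in D\otimes{\bf k}\Omega$ and $[r]\in C_k$. (ii) The pair $(D\otimes{\bf k}\Omega,\{\mu_k\}_{k\geq1})$ is an $A_\infty$-algebra, where $$\mu_k\big(x_1\otimes\alpha_1,\ldots,x_k\otimes\alpha_k\big):=\sum_{r=1}^k(\theta_k)^{[r]}_{\alpha_1,\ldots,\alpha_k}(x_1,\ldots,x_k)\otimes\alpha_1\cdots\alpha_k,\quad\text{for }x_i\otimes\alpha_i\in D\otimes{\bf k}\Omega.$$ Moreover, $(D,\{\eta_k\}_{k\geq1})$ is a representation of the $A_\infty$-algebra $(D\otimes{\bf k}\Omega,\{\mu_k\}_{k\geq1})$, where $$\eta_k\big(x_1\otimes\alpha_1,\ldots,x_r,\ldots,x_k\otimes\alpha_k\big):=(\theta_k)^{[r]}_{\alpha_1,\ldots,\alpha_k}(x_1,\ldots,x_k),$$ for $x_i\otimes\alpha_i\in D\otimes{\bf k}\Omega$ $(i=1,\ldots,r-1,r+1,\ldots,k)$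 and $x_r\in D$; on the right-hand side $\alpha_r$ is taken to be any element of $\Omega$. (iii) The triple $\big((D\otimes{\bf k}\Omega,\{\mu_k\}_{k\geq1}),(D,\{\eta_k\}_{k\geq1}),\{R_\alpha\}_{\alpha\in\Omega}\big)$ is a strict homotopy relative Rota-Baxter family algebra, where $$R_\alpha:D\rightarrow D\otimes{\bf k}\Omega,\quad R_\alpha(x)=x\otimes\alpha,\quad\text{for }\alpha\in\Omega,\ x\in D.$$ Further, the induced Dend$_\infty$-family algebra structure on $D$ coincides with the given one.
   Context: All vector spaces and linear maps are over a field ${\bf k}$ of characteristic $0$; $\Omega$ is a (nonempty) semigroup and ${\bf k}\Omega$ is the vector space with basis $\Omega$, placed in degree $0$ (so $|x\otimes\alpha|=|x|$). $\alpha_1\cdots\alpha_k$ denotes the product in $\Omega$; a subscript $\alpha_1,\ldots,\alpha_i\cdots\alpha_{i+l-1},\ldots,\alpha_n$ means that the labels $\alpha_i,\ldots,\alpha_{i+l-1}$ are replaced by their product. Dend$_\infty$-family algebra. Let $D=\oplus_{i\in\mathbb{Z}}D_i$ be a graded vector space and $C_n=\{[1],\ldots,[n]\}$ for $n\geq 1$. $\mathrm{Hom}^1_{\widehat\Omega}({\bf k}[C_k]\otimes D^{\otimes k},D)$ is the set of collections $\theta_k=\{(\theta_k)_{\alpha_1,\ldots,\alpha_k}:{\bf k}[C_k]\otimes D^{\otimes k}\to D\}_{\alpha_1,\ldots,\alpha_k\in\Omega}$ of linear maps such that, writing $(\theta_k)^{[r]}_{\alpha_1,\ldots,\alpha_k}:=(\theta_k)_{\alpha_1,\ldots,\alpha_k}([r];-,\ldots,-):D^{\otimes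 k}\to D$, each $(\theta_k)^{[r]}_{\alpha_1,\ldots,\alpha_k}$ has degree $1$ and does not depend on $\alpha_r$, for all $1\leq r\leq k$. A Dend$_\infty$-family algebra is a pair $(D,\{\theta_k\}_{k\geq1})$ with $\theta_k\in\mathrm{Hom}^1_{\widehat\Omega}({\bf k}[C_k]\otimes D^{\otimes k},D)$ satisfying, for all $n\geq1$, $[r]\in C_n$, $\alpha_1,\ldots,\alpha_n\in\Omega$ and homogeneous $x_1,\ldots,x_n\in D$, $$\sum_{k+l=n+1}\sum_{i=1}^k(\theta_k\diamond_i\theta_l)^{[r]}_{\alpha_1,\ldots,\alpha_n}(x_1,\ldots,x_n)=0,$$ where, with $\varepsilon=(-1)^{|x_1|+\cdots+|x_{i-1}|}$, $(\theta_k\diamond_i\theta_l)^{[r]}_{\alpha_1,\ldots,\alpha_n}(x_1,\ldots,x_n)$ equals - $\varepsilon\,(\theta_k)^{[r]}_{\alpha_1,\ldots,\alpha_i\cdots\alpha_{i+l-1},\ldots,\alpha_n}\big(x_1,\ldots,x_{i-1},\sum_{s=1}^l(\theta_l)^{[s]}_{\alpha_i,\ldots,\alpha_{i+l-1}}(x_i,\ldots,x_{i+l-1}),x_{i+l},\ldots,x_n\big)$ if $1\leq r\leq i-1$; - $\varepsilon\,(\theta_k)^{[i]}_{\alpha_1,\ldots,\alpha_i\cdots\alpha_{i+l-1},\ldots,\alpha_n}\big(x_1,\ldots,x_{i-1},(\theta_l)^{[r-i+1]}_{\alpha_i,\ldots,\alpha_{i+l-1}}(x_i,\ldots,x_{i+l-1}),x_{i+l},\ldots,x_n\big)$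 if $i\leq r\leq i+l-1$; - $\varepsilon\,(\theta_k)^{[r-l+1]}_{\alpha_1,\ldots,\alpha_i\cdots\alpha_{i+l-1},\ldots,\alpha_n}\big(x_1,\ldots,x_{i-1},\sum_{s=1}^l(\theta_l)^{[s]}_{\alpha_i,\ldots,\alpha_{i+l-1}}(x_i,\ldots,x_{i+l-1}),x_{i+l},\ldots,x_n\big)$ if $i+l\leq r\leq n$. A Dend$_\infty$-algebra is a Dend$_\infty$-family algebra for the one-element semigroup; the labels are then omitted, so its structure maps are degree $1$ linear maps $(\theta_k)^{[r]}:D^{\otimes k}\to D$, $[r]\in C_k$, satisfying, for all $n\geq1$, $[r]\in C_n$ and homogeneous $x_1,\ldots,x_n\in D$, $$\sum_{k+l=n+1}\sum_{i=1}^k(\theta_k\diamond_i\theta_l)^{[r]}(x_1,\ldots,x_n)=0,$$ where, with $\varepsilon=(-1)^{|x_1|+\cdots+|x_{i-1}|}$, $(\theta_k\diamond_i\theta_l)^{[r]}(x_1,\ldots,x_n)$ equals - $\varepsilon\,(\theta_k)^{[r]}\big(x_1,\ldots,x_{i-1},\sum_{s=1}^l(\theta_l)^{[s]}(x_i,\ldots,x_{i+l-1}),x_{i+l},\ldots,x_n\big)$ if $1\leq r\leq i-1$; - $\varepsilon\,(\theta_k)^{[i]}\big(x_1,\ldots,x_{i-1},(\theta_l)^{[r-i+1]}(x_i,\ldots,x_{i+l-1}),x_{i+l},\ldots,x_n\big)$ if $i\leq r\leq i+l-1$; - $\varepsilon\,(\theta_k)^{[r-l+1]}\big(x_1,\ldots,x_{i-1},\sum_{s=1}^l(\theta_l)^{[s]}(x_i,\ldots,x_{i+l-1}),x_{i+l},\ldots,x_n\big)$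 if $i+l\leq r\leq n$. An $A_\infty$-algebra is a graded vector space $A=\oplus_{i\in\mathbb{Z}}A_i$ with degree $1$ linear maps $\mu_k:A^{\otimes k}\to A$, $k\geq1$, satisfying for all $n\geq1$ and homogeneous $a_1,\ldots,a_n\in A$ $$\sum_{k+l=n+1}\sum_{i=1}^k(-1)^{|a_1|+\cdots+|a_{i-1}|}\mu_k\big(a_1,\ldots,a_{i-1},\mu_l(a_i,\ldots,a_{i+l-1}),a_{i+l},\ldots,a_n\big)=0.\quad( * )$$ A representation of it is a graded vector space $M$ with degree $1$ linear maps $\eta_k:\mathcal{A}^{k-1,1}\to M$, $k\geq1$, where $\mathcal{A}^{k-1,1}$ is the direct sum of all $k$-fold tensor products of copies of $A$ and $M$ with $A$ appearing $k-1$ times and $M$ exactly once, satisfying the identities $( * )$ whenever exactly one of $a_1,\ldots,a_n$ is from $M$ and the others are from $A$, with $\mu_k$ or $\mu_l$ replaced by $\eta_k$ or $\eta_l$ wherever the corresponding operation has an input from $M$. A strict homotopy relative Rota-Baxter family algebra is a triple $\big((A,\{\mu_k\}_{k\geq1}),(M,\{\eta_k\}_{k\geq1}),\{R_\alpha\}_{\alpha\in\Omega}\big)$ of an $A_\infty$-algebra, a representation of it, and a collection $\{R_\alpha:M\to A\}_{\alpha\in\Omega}$ of degree $0$ linear maps satisfying $$\mu_k\big(R_{\alpha_1}(u_1),\ldots,R_{\alpha_k}(u_k)\big)=\sum_{r=1}^kR_{\alpha_1\cdots\alpha_k}\big(\eta_k(R_{\alpha_1}(u_1),\ldots,u_r,\ldots,R_{\alpha_k}(u_k))\big)$$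 for all $k\geq1$, $\alpha_1,\ldots,\alpha_k\in\Omega$, $u_1,\ldots,u_k\in M$ (in the $r$-th summand the $r$-th argument is $u_r$). The Dend$_\infty$-family algebra structure on $M$ induced by it is $(\theta_k)^{[r]}_{\alpha_1,\ldots,\alpha_k}(u_1,\ldots,u_k)=\eta_k\big(R_{\alpha_1}(u_1),\ldots,u_r,\ldots,R_{\alpha_k}(u_k)\big)$. *)

theory Defs
  imports Complex_Main "HOL-Library.Poly_Mapping"
begin

section \<open>Graded vector spaces and multilinear maps\<close>

text \<open>
  A vector space is a type with a scalar multiplication; a grading on it is a family of subspaces
  whose internal direct sum is the whole space.
\<close>

definition graded_space ::
  "('k::field \<Rightarrow> 'v::ab_group_add \<Rightarrow> 'v) \<Rightarrow> (int \<Rightarrow> 'v set) \<Rightarrow> bool" where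
  "graded_space s V \<longleftrightarrow>
     vector_space s \<and>
     (\<forall>d. module.subspace s (V d)) \<and>
     (\<forall>x. \<exists>!f :: int \<Rightarrow>\<^sub>0 'v.
        (\<forall>d. Poly_Mapping.lookup f d \<in> V d) \<and>
        x = (\<Sum>d\<in>Poly_Mapping.keys f. Poly_Mapping.lookup f d))"

text \<open>
  A linear map on a \<open>k\<close>-fold tensor power is represented by the corresponding multilinear map, which
  takes the list of its \<open>k\<close> arguments. Its values on lists of another length are irrelevant.
\<close>

definition multilinear ::
  "('k::field \<Rightarrow> 'v::ab_group_add \<Rightarrow> 'v) \<Rightarrow> ('k \<Rightarrow> 'w::ab_group_add \<Rightarrow> 'w) \<Rightarrow> nat \<Rightarrow> ('v list \<Rightarrow> 'w) \<Rightarrow> bool"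
where
  "multilinear s s' k f \<longleftrightarrow>
     (\<forall>xs. length xs = k \<longrightarrow> (\<forall>j<k. Vector_Spaces.linear s s' (\<lambda>x. f (xs[j := x]))))"

definition homogeneous :: "(int \<Rightarrow> 'v set) \<Rightarrow> int list \<Rightarrow> 'v list \<Rightarrow> bool" where
  "homogeneous V ds xs \<longleftrightarrow> list_all2 (\<lambda>d x. x \<in> V d) ds xs"

definition degree_one :: "(int \<Rightarrow> 'v set) \<Rightarrow> (int \<Rightarrow> 'w set) \<Rightarrow> nat \<Rightarrow> ('v list \<Rightarrow> 'w) \<Rightarrow> bool" where
  "degree_one V W k f \<longleftrightarrow>
     (\<forall>ds xs. length xs = k \<longrightarrow> homogeneous V ds xs \<longrightarrow> f xs \<in> W (sum_list ds + 1))"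

text \<open>
  Positions in lists are counted from 1, as in \<open>x\<^sub>1, \<dots>, x\<^sub>n\<close>: \<open>block i l\<close> is
  \<open>x\<^sub>i, \<dots>, x\<^bsub>i+l-1\<^esub>\<close>, and \<open>contract i l\<close> replaces this block by a single entry. The sign in front of
  the \<open>i\<close>-th insertion depends on the degrees \<open>ds\<close> of the arguments.
\<close>

definition block :: "nat \<Rightarrow> nat \<Rightarrow> 'a list \<Rightarrow> 'a list" where
  "block i l xs = take l (drop (i - 1) xs)"

definition contract :: "nat \<Rightarrow> nat \<Rightarrow> 'a list \<Rightarrow> 'a \<Rightarrow> 'a list" where
  "contract i l xs y = take (i - 1) xs @ y # drop (i - 1 + l) xs"

definition insertion_sign :: "nat \<Rightarrow> int list \<Rightarrow> 'k::field" where
  "insertion_sign i ds = (- 1) powi (sum_list (take (i - 1) ds))"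

text \<open>The product of a nonempty list of semigroup elements.\<close>

definition label_prod :: "'w::semigroup_mult list \<Rightarrow> 'w" where
  "label_prod \<alpha>s = foldl (*) (hd \<alpha>s) (tl \<alpha>s)"


section \<open>Homotopy dendriform (family) algebras\<close>

text \<open>
  \<open>\<theta> k r \<alpha>s xs\<close> stands for \<open>(\<theta>\<^sub>k)\<close> with superscript \<open>[r]\<close> and subscript \<open>\<alpha>s\<close>, applied to \<open>xs\<close>.
\<close>

definition dend_family_comp ::
  "(nat \<Rightarrow> nat \<Rightarrow> 'w::semigroup_mult list \<Rightarrow> 'd::ab_group_add list \<Rightarrow> 'd)
    \<Rightarrow> nat \<Rightarrow> nat \<Rightarrow> nat \<Rightarrow> nat \<Rightarrow> 'w list \<Rightarrow> 'd list \<Rightarrow> 'd"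
where
  "dend_family_comp \<theta> k l i r \<alpha>s xs =
    (let \<beta>s = contract i l \<alpha>s (label_prod (block i l \<alpha>s)) in
     if r < i then
       \<theta> k r \<beta>s (contract i l xs (\<Sum>s=1..l. \<theta> l s (block i l \<alpha>s) (block i l xs)))
     else if r < i + l then
       \<theta> k i \<beta>s (contract i l xs (\<theta> l (r - i + 1) (block i l \<alpha>s) (block i l xs)))
     else
       \<theta> k (r - l + 1) \<beta>s (contract i l xs (\<Sum>s=1..l. \<theta> l s (block i l \<alpha>s) (block i l xs))))"

definition dend_inf_family_algebra ::
  "('k::field \<Rightarrow> 'd::ab_group_add \<Rightarrow> 'd) \<Rightarrow> (int \<Rightarrow> 'd set)
    \<Rightarrow> (nat \<Rightarrow> nat \<Rightarrow> 'w::semigroup_mult list \<Rightarrow> 'd list \<Rightarrow> 'd) \<Rightarrow> bool"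
where
  "dend_inf_family_algebra s D \<theta> \<longleftrightarrow>
     graded_space s D \<and>
     (\<forall>k\<ge>1. \<forall>r\<in>{1..k}. \<forall>\<alpha>s. length \<alpha>s = k \<longrightarrow>
        multilinear s s k (\<theta> k r \<alpha>s) \<and>
        degree_one D D k (\<theta> k r \<alpha>s) \<and>
        (\<forall>\<beta> xs. length xs = k \<longrightarrow> \<theta> k r (\<alpha>s[r - 1 := \<beta>]) xs = \<theta> k r \<alpha>s xs)) \<and>
     (\<forall>n\<ge>1. \<forall>r\<in>{1..n}. \<forall>\<alpha>s ds xs.
        length \<alpha>s = n \<longrightarrow> length xs = n \<longrightarrow> homogeneous D ds xs \<longrightarrow>
        (\<Sum>k=1..n. \<Sum>i=1..k.
           s (insertion_sign i ds) (dend_family_comp \<theta> k (n + 1 - k) i r \<alpha>s xs)) = 0)"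

definition dend_comp ::
  "(nat \<Rightarrow> nat \<Rightarrow> 'd::ab_group_add list \<Rightarrow> 'd) \<Rightarrow> nat \<Rightarrow> nat \<Rightarrow> nat \<Rightarrow> nat \<Rightarrow> 'd list \<Rightarrow> 'd"
where
  "dend_comp \<theta> k l i r xs =
    (if r < i then
       \<theta> k r (contract i l xs (\<Sum>s=1..l. \<theta> l s (block i l xs)))
     else if r < i + l then
       \<theta> k i (contract i l xs (\<theta> l (r - i + 1) (block i l xs)))
     else
       \<theta> k (r - l + 1) (contract i l xs (\<Sum>s=1..l. \<theta> l s (block i l xs))))"

definition dend_inf_algebra ::
  "('k::field \<Rightarrow> 'd::ab_group_add \<Rightarrow> 'd) \<Rightarrow> (int \<Rightarrow> 'd set)
    \<Rightarrow> (nat \<Rightarrow> nat \<Rightarrow> 'd list \<Rightarrow> 'd) \<Rightarrow> bool"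
where
  "dend_inf_algebra s D \<theta> \<longleftrightarrow>
     graded_space s D \<and>
     (\<forall>k\<ge>1. \<forall>r\<in>{1..k}. multilinear s s k (\<theta> k r) \<and> degree_one D D k (\<theta> k r)) \<and>
     (\<forall>n\<ge>1. \<forall>r\<in>{1..n}. \<forall>ds xs.
        length xs = n \<longrightarrow> homogeneous D ds xs \<longrightarrow>
        (\<Sum>k=1..n. \<Sum>i=1..k.
           s (insertion_sign i ds) (dend_comp \<theta> k (n + 1 - k) i r xs)) = 0)"

lemma dend_inf_algebra_iff_one_element_family:
  fixes \<theta> :: "nat \<Rightarrow> nat \<Rightarrow> 'w::semigroup_mult list \<Rightarrow> 'd::ab_group_add list \<Rightarrow> 'd"
  assumes one: "\<And>\<alpha> \<beta> :: 'w. \<alpha> = \<beta>"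
  shows "dend_inf_family_algebra s D \<theta> \<longleftrightarrow>
         dend_inf_algebra s D (\<lambda>k r. \<theta> k r (replicate k undefined))"
proof -
  have eq: "\<alpha>s = \<beta>s" if "length \<alpha>s = length \<beta>s" for \<alpha>s \<beta>s :: "'w list"
    using that by (intro nth_equalityI one)
  have labels: "(\<forall>\<alpha>s :: 'w list. length \<alpha>s = k \<longrightarrow> P \<alpha>s) \<longleftrightarrow> P (replicate k undefined)" for k P
  proof
    assume P: "P (replicate k undefined)"
    show "\<forall>\<alpha>s :: 'w list. length \<alpha>s = k \<longrightarrow> P \<alpha>s"
    proof (intro allI impI)
      fix \<alpha>s :: "'w list" assume "length \<alpha>s = k"
      then have "\<alpha>s = replicate k undefined" by (intro eq) simp
      then show "P \<alpha>s" using P by simp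
    qed
  qed simp
  have upd: "(\<alpha>s :: 'w list)[j := \<beta>] = \<alpha>s" for \<alpha>s j \<beta>
    by (rule eq) simp
  have comp: "dend_family_comp \<theta> k (n + 1 - k) i r (replicate n undefined) xs
      = dend_comp (\<lambda>k r. \<theta> k r (replicate k undefined)) k (n + 1 - k) i r xs"
    if "k \<in> {1..n}" "i \<in> {1..k}" for k n i r xs
  proof -
    have b: "block i (n + 1 - k) (replicate n (undefined :: 'w)) = replicate (n + 1 - k) undefined"
      using that by (intro eq) (auto simp: block_def)
    have c: "contract i (n + 1 - k) (replicate n undefined) \<alpha> = replicate k (undefined :: 'w)" for \<alpha>
    proof -
      have "length (contract i (n + 1 - k) (replicate n undefined) \<alpha>) = k"
        using that by (auto simp: contract_def)
      then show ?thesis by (intro eq) simp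
    qed
    show ?thesis unfolding dend_family_comp_def dend_comp_def Let_def b c ..
  qed
  have ident: "(\<forall>\<alpha>s ds xs. length \<alpha>s = n \<longrightarrow> length xs = n \<longrightarrow> homogeneous D ds xs \<longrightarrow>
        (\<Sum>k=1..n. \<Sum>i=1..k.
           s (insertion_sign i ds) (dend_family_comp \<theta> k (n + 1 - k) i r \<alpha>s xs)) = 0)
     \<longleftrightarrow> (\<forall>ds xs. length xs = n \<longrightarrow> homogeneous D ds xs \<longrightarrow>
        (\<Sum>k=1..n. \<Sum>i=1..k. s (insertion_sign i ds)
           (dend_comp (\<lambda>k r. \<theta> k r (replicate k undefined)) k (n + 1 - k) i r xs)) = 0)" for n r
  proof -
    have "(\<Sum>k=1..n. \<Sum>i=1..k. s (insertion_sign i ds)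
           (dend_family_comp \<theta> k (n + 1 - k) i r (replicate n undefined) xs))
        = (\<Sum>k=1..n. \<Sum>i=1..k. s (insertion_sign i ds)
           (dend_comp (\<lambda>k r. \<theta> k r (replicate k undefined)) k (n + 1 - k) i r xs))" for ds xs
      by (intro sum.cong refl) (simp only: comp)
    moreover have "(\<forall>\<alpha>s :: 'w list. \<forall>ds xs. length \<alpha>s = n \<longrightarrow> Q \<alpha>s ds xs)
        \<longleftrightarrow> (\<forall>ds xs. Q (replicate n undefined) ds xs)" for Q :: "'w list \<Rightarrow> int list \<Rightarrow> 'd list \<Rightarrow> bool"
      using labels[of n "\<lambda>\<alpha>s. \<forall>ds xs. Q \<alpha>s ds xs"] by blast
    ultimately show ?thesis by simp
  qed
  show ?thesis
    unfolding dend_inf_family_algebra_def dend_inf_algebra_def ident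
    by (simp add: labels upd)
qed


section \<open>Homotopy associative algebras and their representations\<close>

definition ainf_algebra ::
  "('k::field \<Rightarrow> 'a::ab_group_add \<Rightarrow> 'a) \<Rightarrow> (int \<Rightarrow> 'a set) \<Rightarrow> (nat \<Rightarrow> 'a list \<Rightarrow> 'a) \<Rightarrow> bool"
where
  "ainf_algebra s A \<mu> \<longleftrightarrow>
     graded_space s A \<and>
     (\<forall>k\<ge>1. multilinear s s k (\<mu> k) \<and> degree_one A A k (\<mu> k)) \<and>
     (\<forall>n\<ge>1. \<forall>ds as. length as = n \<longrightarrow> homogeneous A ds as \<longrightarrow>
        (\<Sum>k=1..n. \<Sum>i=1..k. s (insertion_sign i ds)
           (\<mu> k (contract i (n + 1 - k) as (\<mu> (n + 1 - k) (block i (n + 1 - k) as))))) = 0)"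

text \<open>
  Arguments from \<open>A\<close> and \<open>M\<close> are tagged with \<open>Inl\<close> and \<open>Inr\<close>. A list in \<open>mixed_tensors k\<close> is a
  pure tensor in \<open>\<A>\<^bsup>k-1,1\<^esup>\<close>; the position of the \<open>Inr\<close> entry tells the summand it belongs to.
\<close>

definition mixed_tensors :: "nat \<Rightarrow> ('a + 'm) list set" where
  "mixed_tensors k = {zs. length zs = k \<and> (\<exists>as u bs. zs = map Inl as @ Inr u # map Inl bs)}"

definition mixed_grading :: "(int \<Rightarrow> 'a set) \<Rightarrow> (int \<Rightarrow> 'm set) \<Rightarrow> int \<Rightarrow> ('a + 'm) set" where
  "mixed_grading A M d = Inl ` A d \<union> Inr ` M d"

definition mixed_multilinear ::
  "('k::field \<Rightarrow> 'a::ab_group_add \<Rightarrow> 'a) \<Rightarrow> ('k \<Rightarrow> 'm::ab_group_add \<Rightarrow> 'm)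
    \<Rightarrow> nat \<Rightarrow> (('a + 'm) list \<Rightarrow> 'm) \<Rightarrow> bool"
where
  "mixed_multilinear sA sM k f \<longleftrightarrow>
     (\<forall>zs\<in>mixed_tensors k. \<forall>j<k.
        (if isl (zs ! j) then Vector_Spaces.linear sA sM (\<lambda>a. f (zs[j := Inl a]))
         else Vector_Spaces.linear sM sM (\<lambda>u. f (zs[j := Inr u]))))"

text \<open>\<open>\<eta>\<^sub>k\<close> replaces \<open>\<mu>\<^sub>k\<close> as soon as there is an argument from \<open>M\<close>.\<close>

definition mixed_op ::
  "(nat \<Rightarrow> 'a list \<Rightarrow> 'a) \<Rightarrow> (nat \<Rightarrow> ('a + 'm) list \<Rightarrow> 'm) \<Rightarrow> nat \<Rightarrow> ('a + 'm) list \<Rightarrow> 'a + 'm"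
where
  "mixed_op \<mu> \<eta> k zs =
     (if \<forall>z\<in>set zs. isl z then Inl (\<mu> k (map projl zs)) else Inr (\<eta> k zs))"

text \<open>
  When exactly one argument comes from \<open>M\<close>, each term of the identity has its outer operation in
  \<open>M\<close>, so that \<open>projr\<close> below is only applied to an \<open>Inr\<close>.
\<close>

definition ainf_representation ::
  "('k::field \<Rightarrow> 'a::ab_group_add \<Rightarrow> 'a) \<Rightarrow> (int \<Rightarrow> 'a set) \<Rightarrow> (nat \<Rightarrow> 'a list \<Rightarrow> 'a)
    \<Rightarrow> ('k \<Rightarrow> 'm::ab_group_add \<Rightarrow> 'm) \<Rightarrow> (int \<Rightarrow> 'm set) \<Rightarrow> (nat \<Rightarrow> ('a + 'm) list \<Rightarrow> 'm) \<Rightarrow> bool"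
where
  "ainf_representation sA A \<mu> sM M \<eta> \<longleftrightarrow>
     ainf_algebra sA A \<mu> \<and>
     graded_space sM M \<and>
     (\<forall>k\<ge>1. mixed_multilinear sA sM k (\<eta> k) \<and>
        (\<forall>ds. \<forall>zs\<in>mixed_tensors k. homogeneous (mixed_grading A M) ds zs \<longrightarrow>
           \<eta> k zs \<in> M (sum_list ds + 1))) \<and>
     (\<forall>n\<ge>1. \<forall>ds. \<forall>zs\<in>mixed_tensors n. homogeneous (mixed_grading A M) ds zs \<longrightarrow>
        (\<Sum>k=1..n. \<Sum>i=1..k. sM (insertion_sign i ds)
           (projr (mixed_op \<mu> \<eta> k
              (contract i (n + 1 - k) zs (mixed_op \<mu> \<eta> (n + 1 - k) (block i (n + 1 - k) zs)))))) = 0)"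


section \<open>Strict homotopy relative Rota-Baxter family algebras\<close>

text \<open>The tagged list \<open>R\<^bsub>\<alpha>\<^sub>1\<^esub>(u\<^sub>1), \<dots>, u\<^sub>r, \<dots>, R\<^bsub>\<alpha>\<^sub>k\<^esub>(u\<^sub>k)\<close>.\<close>

definition rb_args :: "('w \<Rightarrow> 'm \<Rightarrow> 'a) \<Rightarrow> nat \<Rightarrow> 'w list \<Rightarrow> 'm list \<Rightarrow> ('a + 'm) list" where
  "rb_args R r \<alpha>s us = (map2 (\<lambda>\<alpha> u. Inl (R \<alpha> u)) \<alpha>s us)[r - 1 := Inr (us ! (r - 1))]"

definition strict_rel_rota_baxter_family ::
  "('k::field \<Rightarrow> 'a::ab_group_add \<Rightarrow> 'a) \<Rightarrow> (int \<Rightarrow> 'a set) \<Rightarrow> (nat \<Rightarrow> 'a list \<Rightarrow> 'a)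
    \<Rightarrow> ('k \<Rightarrow> 'm::ab_group_add \<Rightarrow> 'm) \<Rightarrow> (int \<Rightarrow> 'm set) \<Rightarrow> (nat \<Rightarrow> ('a + 'm) list \<Rightarrow> 'm)
    \<Rightarrow> ('w::semigroup_mult \<Rightarrow> 'm \<Rightarrow> 'a) \<Rightarrow> bool"
where
  "strict_rel_rota_baxter_family sA A \<mu> sM M \<eta> R \<longleftrightarrow>
     ainf_algebra sA A \<mu> \<and>
     ainf_representation sA A \<mu> sM M \<eta> \<and>
     (\<forall>\<alpha>. Vector_Spaces.linear sM sA (R \<alpha>) \<and> (\<forall>d. \<forall>u\<in>M d. R \<alpha> u \<in> A d)) \<and>
     (\<forall>k\<ge>1. \<forall>\<alpha>s us. length \<alpha>s = k \<longrightarrow> length us = k \<longrightarrow>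
        \<mu> k (map2 R \<alpha>s us) = (\<Sum>r=1..k. R (label_prod \<alpha>s) (\<eta> k (rb_args R r \<alpha>s us))))"

definition induced_dend_family ::
  "(nat \<Rightarrow> ('a + 'm) list \<Rightarrow> 'm) \<Rightarrow> ('w \<Rightarrow> 'm \<Rightarrow> 'a) \<Rightarrow> nat \<Rightarrow> nat \<Rightarrow> 'w list \<Rightarrow> 'm list \<Rightarrow> 'm"
where
  "induced_dend_family \<eta> R k r \<alpha>s us = \<eta> k (rb_args R r \<alpha>s us)"


section \<open>The tensor product with the space spanned by the semigroup\<close>

text \<open>
  The space with basis \<open>\<Omega>\<close> is \<open>'w \<Rightarrow>\<^sub>0 'k\<close>, and its tensor product with \<open>D\<close> is realised as the space
  \<open>'w \<Rightarrow>\<^sub>0 'd\<close> of finitely supported functions from \<open>\<Omega>\<close> to \<open>D\<close>; \<open>x \<otimes> \<alpha>\<close> is the function with value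
  \<open>x\<close> at \<open>\<alpha>\<close> and \<open>0\<close> elsewhere. The lemma \<open>tensor_universal_property\<close> shows that this is
  the tensor product.
\<close>

definition tensor_scale :: "('k::zero \<Rightarrow> 'd::zero \<Rightarrow> 'd) \<Rightarrow> 'k \<Rightarrow> ('w \<Rightarrow>\<^sub>0 'd) \<Rightarrow> ('w \<Rightarrow>\<^sub>0 'd)" where
  "tensor_scale s c = Poly_Mapping.map (s c)"

definition tensor_grading :: "(int \<Rightarrow> 'd::zero set) \<Rightarrow> int \<Rightarrow> ('w \<Rightarrow>\<^sub>0 'd) set" where
  "tensor_grading D d = {f. \<forall>\<alpha>. Poly_Mapping.lookup f \<alpha> \<in> D d}"

definition pure_tensor :: "'d::zero \<Rightarrow> 'w \<Rightarrow> ('w \<Rightarrow>\<^sub>0 'd)" where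
  "pure_tensor x \<alpha> = Poly_Mapping.single \<alpha> x"

definition tensor :: "('k::zero \<Rightarrow> 'd::zero \<Rightarrow> 'd) \<Rightarrow> 'd \<Rightarrow> ('w \<Rightarrow>\<^sub>0 'k) \<Rightarrow> ('w \<Rightarrow>\<^sub>0 'd)" where
  "tensor s x p = Poly_Mapping.map (\<lambda>c. s c x) p"

context vector_space
begin

lemma lookup_tensor_scale: "Poly_Mapping.lookup (tensor_scale scale c f) \<alpha> = scale c (Poly_Mapping.lookup f \<alpha>)"
  by (simp add: tensor_scale_def Poly_Mapping.map.rep_eq when_def)

lemma lookup_tensor: "Poly_Mapping.lookup (tensor scale x p) \<alpha> = scale (Poly_Mapping.lookup p \<alpha>) x"
  by (simp add: tensor_def Poly_Mapping.map.rep_eq when_def)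

lemma vector_space_tensor: "vector_space (tensor_scale scale :: _ \<Rightarrow> ('w \<Rightarrow>\<^sub>0 'b) \<Rightarrow> _)"
  by unfold_locales
    (auto intro!: poly_mapping_eqI
      simp: lookup_tensor_scale Poly_Mapping.lookup_add scale_right_distrib scale_left_distrib)

lemma tensor_single: "tensor scale x (Poly_Mapping.single \<alpha> 1) = pure_tensor x \<alpha>"
  by (rule poly_mapping_eqI) (simp add: lookup_tensor pure_tensor_def lookup_single when_def)

end

lemma poly_mapping_as_sum:
  "f = (\<Sum>\<alpha>\<in>Poly_Mapping.keys f. pure_tensor (Poly_Mapping.lookup f \<alpha>) \<alpha>)"
  for f :: "'w \<Rightarrow>\<^sub>0 'd::ab_group_add"
  by (rule poly_mapping_eqI)
    (auto simp: lookup_sum pure_tensor_def lookup_single when_def sum.delta' not_in_keys_iff_lookup_eq_zero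
       if_distrib cong: if_cong)

theorem tensor_universal_property:
  fixes s :: "'k::field \<Rightarrow> 'd::ab_group_add \<Rightarrow> 'd"
    and sV :: "'k \<Rightarrow> 'v::ab_group_add \<Rightarrow> 'v"
    and B :: "'d \<Rightarrow> ('w \<Rightarrow>\<^sub>0 'k) \<Rightarrow> 'v"
  assumes D: "vector_space s" and V: "vector_space sV"
    and B1: "\<And>p. Vector_Spaces.linear s sV (\<lambda>x. B x p)"
    and B2: "\<And>x. Vector_Spaces.linear (tensor_scale (*)) sV (B x)"
  shows "(\<forall>p. Vector_Spaces.linear s (tensor_scale s) (\<lambda>x. tensor s x (p :: 'w \<Rightarrow>\<^sub>0 'k)))"
    and "(\<forall>x. Vector_Spaces.linear (tensor_scale (*)) (tensor_scale s) (tensor s x :: ('w \<Rightarrow>\<^sub>0 'k) \<Rightarrow> _))"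
    and "\<exists>!L. Vector_Spaces.linear (tensor_scale s) sV L \<and> (\<forall>x p. L (tensor s x p) = B x p)"
proof -
  interpret D: vector_space s by fact
  interpret V: vector_space sV by fact
  interpret K: vector_space "(*) :: 'k \<Rightarrow> 'k \<Rightarrow> 'k" by unfold_locales (auto simp: algebra_simps)
  interpret KW: vector_space "tensor_scale (*) :: 'k \<Rightarrow> ('w \<Rightarrow>\<^sub>0 'k) \<Rightarrow> _" by (rule K.vector_space_tensor)
  interpret T: vector_space "tensor_scale s :: 'k \<Rightarrow> ('w \<Rightarrow>\<^sub>0 'd) \<Rightarrow> _" by (rule D.vector_space_tensor)
  show "\<forall>p. Vector_Spaces.linear s (tensor_scale s) (\<lambda>x. tensor s x (p :: 'w \<Rightarrow>\<^sub>0 'k))"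
    by (auto intro!: Vector_Spaces.linear_iff[THEN iffD2] D.vector_space_axioms T.vector_space_axioms poly_mapping_eqI
        simp: D.lookup_tensor D.lookup_tensor_scale lookup_add D.scale_right_distrib mult.commute)
  show "\<forall>x. Vector_Spaces.linear (tensor_scale (*)) (tensor_scale s) (tensor s x :: ('w \<Rightarrow>\<^sub>0 'k) \<Rightarrow> _)"
    by (auto intro!: Vector_Spaces.linear_iff[THEN iffD2] KW.vector_space_axioms T.vector_space_axioms poly_mapping_eqI
        simp: D.lookup_tensor D.lookup_tensor_scale K.lookup_tensor_scale lookup_add D.scale_left_distrib)
  define e where "e \<alpha> = (Poly_Mapping.single \<alpha> 1 :: 'w \<Rightarrow>\<^sub>0 'k)" for \<alpha>
  define L where "L h = (\<Sum>\<alpha>\<in>Poly_Mapping.keys h. B (Poly_Mapping.lookup h \<alpha>) (e \<alpha>))" for h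
  have lin1: "B (x + y) p = B x p + B y p" "B (s c x) p = sV c (B x p)" for x y c p
    using B1[of p] by (auto simp: Vector_Spaces.linear_iff)
  have lin2: "B x (p + q) = B x p + B x q" "B x (tensor_scale (*) c p) = sV c (B x p)" for x p q c
    using B2[of x] by (auto simp: Vector_Spaces.linear_iff)
  have z1: "B 0 p = 0" for p using lin1(1)[of 0 0 p] by simp
  have z2: "B x 0 = 0" for x using lin2(1)[of x 0 0] by simp
  have Lsup: "L h = (\<Sum>\<alpha>\<in>A. B (Poly_Mapping.lookup h \<alpha>) (e \<alpha>))"
    if "finite A" "Poly_Mapping.keys h \<subseteq> A" for h A
    unfolding L_def using that
    by (intro sum.mono_neutral_left) (auto simp: z1 not_in_keys_iff_lookup_eq_zero)
  have Ladd: "L (f + g) = L f + L g" for f g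
  proof -
    let ?A = "Poly_Mapping.keys f \<union> Poly_Mapping.keys g"
    have "L (f + g) = (\<Sum>\<alpha>\<in>?A. B (Poly_Mapping.lookup (f + g) \<alpha>) (e \<alpha>))"
      by (rule Lsup) (auto simp: Poly_Mapping.keys_add)
    also have "\<dots> = (\<Sum>\<alpha>\<in>?A. B (Poly_Mapping.lookup f \<alpha>) (e \<alpha>)) + (\<Sum>\<alpha>\<in>?A. B (Poly_Mapping.lookup g \<alpha>) (e \<alpha>))"
      by (simp add: lookup_add lin1 sum.distrib)
    finally show ?thesis by (simp add: Lsup[of ?A])
  qed
  have Lscale: "L (tensor_scale s c f) = sV c (L f)" for c f
  proof -
    have "L (tensor_scale s c f) = (\<Sum>\<alpha>\<in>Poly_Mapping.keys f. B (Poly_Mapping.lookup (tensor_scale s c f) \<alpha>) (e \<alpha>))"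
      by (rule Lsup) (auto simp: in_keys_iff D.lookup_tensor_scale)
    then show ?thesis by (simp add: L_def D.lookup_tensor_scale lin1 V.scale_sum_right)
  qed
  have Bsum: "B x (\<Sum>\<alpha>\<in>A. p \<alpha>) = (\<Sum>\<alpha>\<in>A. B x (p \<alpha>))" if "finite A" for x and A :: "'w set" and p
    using that by (induction A rule: finite_induct) (auto simp: z2 lin2)
  have Lt: "L (tensor s x p) = B x p" for x p
  proof -
    have "L (tensor s x p) = (\<Sum>\<alpha>\<in>Poly_Mapping.keys p. B (Poly_Mapping.lookup (tensor s x p) \<alpha>) (e \<alpha>))"
      by (rule Lsup) (auto simp: in_keys_iff D.lookup_tensor)
    also have "\<dots> = (\<Sum>\<alpha>\<in>Poly_Mapping.keys p. B x (tensor_scale (*) (Poly_Mapping.lookup p \<alpha>) (e \<alpha>)))"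
      by (simp add: D.lookup_tensor lin1 lin2)
    also have "\<dots> = B x (\<Sum>\<alpha>\<in>Poly_Mapping.keys p. tensor_scale (*) (Poly_Mapping.lookup p \<alpha>) (e \<alpha>))"
      by (simp add: Bsum)
    also have "(\<Sum>\<alpha>\<in>Poly_Mapping.keys p. tensor_scale (*) (Poly_Mapping.lookup p \<alpha>) (e \<alpha>)) = p"
    proof -
      have "tensor_scale (*) c (e \<alpha>) = pure_tensor c \<alpha>" for c \<alpha>
        by (rule poly_mapping_eqI)
          (simp add: K.lookup_tensor_scale e_def pure_tensor_def lookup_single when_def)
      then show ?thesis using poly_mapping_as_sum[of p] by simp
    qed
    finally show ?thesis .
  qed
  show "\<exists>!L. Vector_Spaces.linear (tensor_scale s) sV L \<and> (\<forall>x p. L (tensor s x p) = B x p)"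
  proof (rule ex1I[of _ L])
    show "Vector_Spaces.linear (tensor_scale s) sV L \<and> (\<forall>x p. L (tensor s x p) = B x p)"
      using Ladd Lscale Lt T.vector_space_axioms V.vector_space_axioms
      by (auto simp: Vector_Spaces.linear_iff)
  next
    fix L' assume L': "Vector_Spaces.linear (tensor_scale s) sV L' \<and> (\<forall>x p. L' (tensor s x p) = B x p)"
    then interpret L': Vector_Spaces.linear "tensor_scale s" sV L' by simp
    show "L' = L"
    proof
      fix h
      have "L' h = L' (\<Sum>\<alpha>\<in>Poly_Mapping.keys h. tensor s (Poly_Mapping.lookup h \<alpha>) (e \<alpha>))"
        using poly_mapping_as_sum[of h] by (simp add: e_def D.tensor_single)
      also have "\<dots> = L h"
        using L' by (simp add: L'.sum L_def)
      finally show "L' h = L h" .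
    qed
  qed
qed

text \<open>
  With \<open>\<Omega>\<close> in degree \<open>0\<close>, the degree \<open>d\<close> part is spanned by the \<open>x \<otimes> \<alpha>\<close> with \<open>x\<close> of degree \<open>d\<close>.
\<close>

lemma tensor_grading_eq_span:
  fixes s :: "'k::field \<Rightarrow> 'd::ab_group_add \<Rightarrow> 'd"
  assumes "graded_space s D"
  shows "tensor_grading D d = module.span (tensor_scale s) {pure_tensor x (\<alpha> :: 'w) | x \<alpha>. x \<in> D d}"
proof -
  interpret D: vector_space s using assms by (simp add: graded_space_def)
  interpret T: vector_space "tensor_scale s :: 'k \<Rightarrow> ('w \<Rightarrow>\<^sub>0 'd) \<Rightarrow> _" by (rule D.vector_space_tensor)
  have sub: "D.subspace (D d)" using assms by (simp add: graded_space_def)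
  show ?thesis
  proof
    show "tensor_grading D d \<subseteq> T.span {pure_tensor x (\<alpha> :: 'w) | x \<alpha>. x \<in> D d}"
    proof
      fix f :: "'w \<Rightarrow>\<^sub>0 'd" assume "f \<in> tensor_grading D d"
      then have "(\<Sum>\<alpha>\<in>Poly_Mapping.keys f. pure_tensor (Poly_Mapping.lookup f \<alpha>) \<alpha>)
          \<in> T.span {pure_tensor x (\<alpha> :: 'w) | x \<alpha>. x \<in> D d}"
        by (intro T.span_sum T.span_base) (auto simp: tensor_grading_def)
      then show "f \<in> T.span {pure_tensor x (\<alpha> :: 'w) | x \<alpha>. x \<in> D d}"
        by (simp only: poly_mapping_as_sum[symmetric])
    qed
    show "T.span {pure_tensor x (\<alpha> :: 'w) | x \<alpha>. x \<in> D d} \<subseteq> tensor_grading D d"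
      using sub
      by (intro T.span_minimal T.subspaceI)
        (auto simp: tensor_grading_def pure_tensor_def lookup_single when_def lookup_add
           D.lookup_tensor_scale D.subspace_0 D.subspace_add D.subspace_scale)
  qed
qed

text \<open>
  The operations on \<open>D \<otimes> k\<Omega>\<close> are prescribed on tensors \<open>x \<otimes> \<alpha>\<close> and extended multilinearly, by
  expanding each argument as the sum of the tensors \<open>f(\<alpha>) \<otimes> \<alpha>\<close> over its support.
\<close>

definition theta_bar ::
  "(nat \<Rightarrow> nat \<Rightarrow> 'w::semigroup_mult list \<Rightarrow> 'd::ab_group_add list \<Rightarrow> 'd)
    \<Rightarrow> nat \<Rightarrow> nat \<Rightarrow> ('w \<Rightarrow>\<^sub>0 'd) list \<Rightarrow> ('w \<Rightarrow>\<^sub>0 'd)"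
where
  "theta_bar \<theta> k r fs =
     (\<Sum>\<alpha>s\<in>listset (map Poly_Mapping.keys fs).
        pure_tensor (\<theta> k r \<alpha>s (map2 Poly_Mapping.lookup fs \<alpha>s)) (label_prod \<alpha>s))"

definition mu_tensor ::
  "(nat \<Rightarrow> nat \<Rightarrow> 'w::semigroup_mult list \<Rightarrow> 'd::ab_group_add list \<Rightarrow> 'd)
    \<Rightarrow> nat \<Rightarrow> ('w \<Rightarrow>\<^sub>0 'd) list \<Rightarrow> ('w \<Rightarrow>\<^sub>0 'd)"
where
  "mu_tensor \<theta> k fs =
     (\<Sum>\<alpha>s\<in>listset (map Poly_Mapping.keys fs).
        \<Sum>r=1..k. pure_tensor (\<theta> k r \<alpha>s (map2 Poly_Mapping.lookup fs \<alpha>s)) (label_prod \<alpha>s))"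

text \<open>
  The argument from \<open>D\<close>, at position \<open>r\<close>, carries no label. As \<open>(\<theta>\<^sub>k)\<close> with superscript \<open>[r]\<close> does not
  depend on the \<open>r\<close>-th label, the arbitrary label \<open>undefined\<close> is used for it.
\<close>

definition eta_tensor ::
  "(nat \<Rightarrow> nat \<Rightarrow> 'w list \<Rightarrow> 'd::ab_group_add list \<Rightarrow> 'd)
    \<Rightarrow> nat \<Rightarrow> (('w \<Rightarrow>\<^sub>0 'd) + 'd) list \<Rightarrow> 'd"
where
  "eta_tensor \<theta> k zs =
     (let r = length (takeWhile isl zs) + 1;
          labels = (\<lambda>z. case z of Inl f \<Rightarrow> Poly_Mapping.keys f | Inr x \<Rightarrow> {undefined});
          coefficient = (\<lambda>z \<alpha>. case z of Inl f \<Rightarrow> Poly_Mapping.lookup f \<alpha> | Inr x \<Rightarrow> x)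
      in \<Sum>\<alpha>s\<in>listset (map labels zs). \<theta> k r \<alpha>s (map2 coefficient zs \<alpha>s))"

end

theory Submission
  imports Defs
begin

text \<open>
  On tensors \<open>x \<otimes> \<alpha>\<close>, each term of the dendriform identities for \<open>D \<otimes> k\<Omega>\<close> is the corresponding term for
  \<open>D\<close> tensored with the product of all the labels; both sides are multilinear, so the identities
  extend to all homogeneous arguments. Summing them over \<open>r\<close> gives the \<open>A\<^sub>\<infinity>\<close> identities. An element
  \<open>x\<close> of the representation is treated as \<open>x \<otimes> \<beta>\<close> for an arbitrary label \<open>\<beta>\<close>: then \<open>\<eta>\<^sub>k\<close> with the module
  argument at position \<open>r\<close> is the \<open>r\<close>-th dendriform operation followed by the map \<open>x \<otimes> \<alpha> \<mapsto> x\<close> that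
  forgets labels, and the representation identities are the image of the \<open>r\<close>-th dendriform identity
  under this map.
\<close>

section \<open>Lists of labels\<close>

lemma listset_iff: "xs \<in> listset As \<longleftrightarrow> list_all2 (\<in>) xs As"
  by (induction As arbitrary: xs) (auto simp: set_Cons_def list_all2_Cons2)

lemma listset_singletons: "listset (map (\<lambda>x. {x}) xs) = {xs}"
  by (induction xs) (auto simp: set_Cons_def)

lemma set_Cons_eq_image: "set_Cons A B = (\<lambda>(x, ys). x # ys) ` (A \<times> B)"
  by (auto simp: set_Cons_def)

lemma finite_listset: "(\<And>A. A \<in> set As \<Longrightarrow> finite A) \<Longrightarrow> finite (listset As)"
  by (induction As) (simp_all add: set_Cons_eq_image)

text \<open>Separates the choice of the first label from the others, which is the induction step for
  \<open>multilinear_expand\<close>.\<close>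

lemma sum_set_Cons: "(\<Sum>xs\<in>set_Cons A B. g xs) = (\<Sum>x\<in>A. \<Sum>ys\<in>B. g (x # ys))"
proof -
  have "(\<Sum>xs\<in>set_Cons A B. g xs) = (\<Sum>(x, ys)\<in>A \<times> B. g (x # ys))"
    unfolding set_Cons_eq_image by (subst sum.reindex) (auto simp: inj_on_def case_prod_unfold)
  then show ?thesis by (simp add: sum.cartesian_product)
qed

text \<open>A semigroup has no unit, so both lists must be nonempty for the two products to mean
  anything; associativity then moves the left factor out of \<open>foldl\<close>.\<close>

lemma label_prod_append:
  assumes "xs \<noteq> []" "ys \<noteq> []"
  shows "label_prod (xs @ ys) = label_prod xs * label_prod ys"
proof -
  have "foldl (*) (a * b) zs = a * foldl (*) b zs" for a b :: 'a and zs
    by (induction zs arbitrary: b) (auto simp: mult.assoc)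
  then show ?thesis using assms by (cases xs; cases ys) (auto simp: label_prod_def)
qed

lemma label_prod_singleton [simp]: "label_prod [x] = x"
  by (simp add: label_prod_def)

text \<open>This is generalized associativity. Empty neighbours \<open>xs\<close> or
  \<open>zs\<close> are split off as separate cases because \<open>label_prod_append\<close> only
  applies to nonempty lists.\<close>

lemma label_prod_collapse:
  assumes "ys \<noteq> []"
  shows "label_prod (xs @ label_prod ys # zs) = label_prod (xs @ ys @ zs)"
proof -
  have "label_prod (label_prod ys # zs) = label_prod (ys @ zs)"
    using assms label_prod_append[of "[label_prod ys]" zs] label_prod_append[of ys zs]
    by (cases "zs = []") auto
  then show ?thesis
    using assms label_prod_append[of xs "label_prod ys # zs"] label_prod_append[of xs "ys @ zs"]
    by (cases "xs = []") auto
qed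

text \<open>Ensures that all terms of one dendriform identity carry the same label on the tensor
  product, so that they can be added there.\<close>

lemma label_prod_contract:
  assumes "1 \<le> i" "1 \<le> l" "i + l \<le> length \<alpha>s + 1"
  shows "label_prod (contract i l \<alpha>s (label_prod (block i l \<alpha>s))) = label_prod \<alpha>s"
proof -
  have "block i l \<alpha>s \<noteq> []" using assms by (auto simp: block_def)
  moreover have "take (i - 1) \<alpha>s @ block i l \<alpha>s @ drop (i - 1 + l) \<alpha>s = \<alpha>s"
    unfolding block_def by (metis add.commute append_take_drop_id drop_drop)
  ultimately show ?thesis by (simp add: contract_def label_prod_collapse)
qed


section \<open>Blocks and contractions\<close>

lemma length_block: "1 \<le> i \<Longrightarrow> i + l \<le> length xs + 1 \<Longrightarrow> length (block i l xs) = l"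
  by (auto simp: block_def)

lemma length_contract:
  "1 \<le> i \<Longrightarrow> i + l \<le> length xs + 1 \<Longrightarrow> length (contract i l xs y) = length xs + 1 - l"
  by (auto simp: contract_def)

lemma nth_block:
  "1 \<le> i \<Longrightarrow> i + l \<le> length xs + 1 \<Longrightarrow> j < l \<Longrightarrow> block i l xs ! j = xs ! (i - 1 + j)"
  by (auto simp: block_def)

lemma nth_contract:
  assumes "1 \<le> i" "i + l \<le> length xs + 1" "j < length xs + 1 - l"
  shows "contract i l xs y ! j =
    (if j < i - 1 then xs ! j else if j = i - 1 then y else xs ! (j + l - 1))"
proof -
  have "length (take (i - 1) xs) = i - 1" using assms by auto
  then show ?thesis
    using assms by (auto simp: contract_def nth_append nth_Cons' intro!: arg_cong[where f = "nth xs"])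
qed

lemma map_block: "map f (block i l xs) = block i l (map f xs)"
  by (simp add: block_def take_map drop_map)

lemma map_contract: "map f (contract i l xs y) = contract i l (map f xs) (f y)"
  by (simp add: contract_def take_map drop_map)

lemma map2_block: "map2 f (block i l xs) (block i l ys) = block i l (map2 f xs ys)"
  by (simp add: block_def take_map drop_map take_zip drop_zip)

lemma map2_contract:
  assumes "length xs = length ys"
  shows "map2 f (contract i l xs x) (contract i l ys y) = contract i l (map2 f xs ys) (f x y)"
  using assms by (simp add: contract_def take_map drop_map take_zip drop_zip)

text \<open>Rewrites a contraction as an update at the slot of the inserted entry, the form in which
  \<open>multilinear\<close> speaks about dependence on one argument.\<close>

lemma contract_update_slot:
  assumes "1 \<le> i" "i + l \<le> length xs + 1"
  shows "(contract i l xs y)[i - 1 := z] = contract i l xs z"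
  using assms by (auto simp: contract_def list_update_append)

lemma contract_list_update:
  assumes "1 \<le> i" "i + l \<le> length xs + 1" "j < length xs"
  shows "contract i l (xs[j := x]) y =
    (if j < i - 1 then (contract i l xs y)[j := x]
     else if j < i - 1 + l then contract i l xs y
     else (contract i l xs y)[j + 1 - l := x])"
proof -
  have take: "length (take (i - 1) xs) = i - 1" using assms by auto
  consider "j < i - 1" | "i - 1 \<le> j" "j < i - 1 + l" | "i - 1 + l \<le> j" by linarith
  then show ?thesis
  proof cases
    case 1
    then show ?thesis
      unfolding contract_def using take
      by (simp add: list_update_append take_update_swap drop_update_cancel)
  next
    case 2
    then show ?thesis
      unfolding contract_def by (simp add: take_update_cancel drop_update_cancel)
  next
    case 3
    \<comment> \<open>The inserted entry follows the first \<open>i - 1\<close> entries, so an entry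
      behind the block sits one place further than its index in the dropped list.\<close>
    then have "j + 1 - l - (i - 1) = Suc (j - (i - 1 + l))" "\<not> j + 1 - l < i - 1"
      using assms by auto
    then have "(contract i l xs y)[j + 1 - l := x] =
        take (i - 1) xs @ y # (drop (i - 1 + l) xs)[j - (i - 1 + l) := x]"
      by (simp only: contract_def list_update_append take if_False list_update.simps nat.case)
    then show ?thesis
      unfolding contract_def using 3 by (simp add: take_update_cancel drop_update_swap)
  qed
qed

lemma block_list_update:
  assumes "1 \<le> i" "i + l \<le> length xs + 1" "j < length xs"
  shows "block i l (xs[j := x]) =
    (if i - 1 \<le> j \<and> j < i - 1 + l then (block i l xs)[j - (i - 1) := x] else block i l xs)"
  using assms by (auto simp: block_def drop_update_swap drop_update_cancel take_update_swap
      take_update_cancel list_update_beyond)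

lemma map2_list_update:
  assumes "length xs = length ys"
  shows "(map2 f xs ys)[j := f x y] = map2 f (xs[j := x]) (ys[j := y])"
  using assms
proof (induction xs ys arbitrary: j rule: list_induct2)
  case (Cons a as b bs)
  then show ?case by (cases j) auto
qed simp


section \<open>Multilinear maps\<close>

lemma linear_comp:
  "Vector_Spaces.linear s1 s2 f \<Longrightarrow> Vector_Spaces.linear s2 s3 g \<Longrightarrow>
    Vector_Spaces.linear s1 s3 (\<lambda>x. g (f x))"
  by (auto simp: Vector_Spaces.linear_iff)

lemma linear_scaled:
  assumes "Vector_Spaces.linear s1 s2 f"
  shows "Vector_Spaces.linear s1 s2 (\<lambda>x. s2 c (f x))"
proof -
  interpret vector_space s2 using assms by (simp add: Vector_Spaces.linear_iff)
  show ?thesis using assms by (auto simp: Vector_Spaces.linear_iff scale_right_distrib mult.commute)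
qed

lemma linear_sum:
  assumes "vector_space s1" "vector_space s2" "\<And>i. i \<in> I \<Longrightarrow> Vector_Spaces.linear s1 s2 (f i)"
  shows "Vector_Spaces.linear s1 s2 (\<lambda>x. \<Sum>i\<in>I. f i x)"
proof -
  interpret vector_space s2 by fact
  show ?thesis
    using assms by (auto simp: Vector_Spaces.linear_iff sum.distrib scale_sum_right)
qed

lemma linear_0: "Vector_Spaces.linear s1 s2 f \<Longrightarrow> f 0 = 0"
  by (metis Vector_Spaces.linear_iff add_cancel_right_right)

lemma linear_setsum:
  "Vector_Spaces.linear s1 s2 f \<Longrightarrow> f (\<Sum>i\<in>I. g i) = (\<Sum>i\<in>I. f (g i))"
  by (rule module_hom.sum) (auto simp: Vector_Spaces.linear_def)

lemma multilinear_sum: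
  assumes "vector_space s" "vector_space s'" "\<And>i. i \<in> I \<Longrightarrow> multilinear s s' n (f i)"
  shows "multilinear s s' n (\<lambda>xs. \<Sum>i\<in>I. f i xs)"
  using assms unfolding multilinear_def by (auto intro!: linear_sum)

lemma multilinear_scaled:
  "multilinear s s' n f \<Longrightarrow> multilinear s s' n (\<lambda>xs. s' c (f xs))"
  unfolding multilinear_def by (auto intro!: linear_scaled)

lemma multilinear_comp_linear:
  "multilinear s s' n f \<Longrightarrow> Vector_Spaces.linear s' s'' g \<Longrightarrow> multilinear s s'' n (\<lambda>xs. g (f xs))"
  unfolding multilinear_def using linear_comp[of s s' _ s'' g] by simp

lemma multilinearD:
  "multilinear s s' n f \<Longrightarrow> length xs = n \<Longrightarrow> j < n \<Longrightarrow> Vector_Spaces.linear s s' (\<lambda>x. f (xs[j := x]))"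
  unfolding multilinear_def by auto

text \<open>Linearity in the \<open>j\<close>-th argument applies once \<open>xs\<close> is seen as
  its own update at \<open>j\<close>. This discards the label lists outside the supports.\<close>

lemma multilinear_zero_arg:
  assumes "multilinear s s' n f" "length xs = n" "j < n" "xs ! j = 0"
  shows "f xs = 0"
  using linear_0[OF multilinearD[OF assms(1-3)]] assms(4) by (metis list_update_id)

text \<open>A single variable lies before, inside or behind the block: outside it enters only the
  outer map directly, inside it enters only through \<open>G\<close>.\<close>

lemma multilinear_insertion:
  assumes F: "multilinear s s' k F" and G: "multilinear s s l G" and i: "1 \<le> i" "i \<le> k"
    and n: "n + 1 = k + l"
  shows "multilinear s s' n (\<lambda>xs. F (contract i l xs (G (block i l xs))))"
  unfolding multilinear_def
proof (intro allI impI)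
  fix xs :: "'b list" and j assume xs: "length xs = n" and j: "j < n"
  have il: "i + l \<le> length xs + 1" using xs i n by simp
  have len: "length (contract i l xs y) = k" for y
    using length_contract[OF i(1) il] xs n by simp
  consider "j < i - 1" | "i - 1 \<le> j" "j < i - 1 + l" | "i - 1 + l \<le> j" by linarith
  then show "Vector_Spaces.linear s s' (\<lambda>x. F (contract i l (xs[j := x]) (G (block i l (xs[j := x])))))"
  proof cases
    case 1
    then show ?thesis
      using multilinearD[OF F len, of j] i il j xs
      by (simp add: contract_list_update block_list_update)
  next
    case 2
    \<comment> \<open>Inside the block the dependence is a composition of two linear maps. The entry
      \<open>0\<close> in the contraction below is a placeholder that the update overwrites.\<close>
    have "Vector_Spaces.linear s s (\<lambda>x. G ((block i l xs)[j - (i - 1) := x]))"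
      using 2 i il by (intro multilinearD[OF G]) (auto simp: length_block)
    moreover have "Vector_Spaces.linear s s' (\<lambda>y. F ((contract i l xs 0)[i - 1 := y]))"
      using i by (intro multilinearD[OF F] len) auto
    ultimately have "Vector_Spaces.linear s s'
        (\<lambda>x. F ((contract i l xs 0)[i - 1 := G ((block i l xs)[j - (i - 1) := x])]))"
      by (rule linear_comp)
    then show ?thesis
      using 2 i(1) il j xs
      by (simp add: contract_list_update block_list_update contract_update_slot[OF i(1) il] del: One_nat_def)
  next
    case 3
    then have "contract i l (xs[j := x]) y = (contract i l xs y)[j + 1 - l := x]"
      "block i l (xs[j := x]) = block i l xs" for x y
      using contract_list_update[OF i(1) il] block_list_update[OF i(1) il] j xs by auto
    moreover have "j + 1 - l < k" using 3 i j n by auto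
    ultimately show ?thesis using multilinearD[OF F len] by simp
  qed
qed


section \<open>The sum of the coefficients\<close>

text \<open>With labels as indices this is the linear map sending x tensor \<alpha> to x, that is,
  the identity on the space tensored with the augmentation of the semigroup algebra. With degrees as
  indices it is the sum of homogeneous components in \<open>graded_space\<close>.\<close>

definition total :: "('i \<Rightarrow>\<^sub>0 'a::comm_monoid_add) \<Rightarrow> 'a" where
  "total f = (\<Sum>i\<in>Poly_Mapping.keys f. Poly_Mapping.lookup f i)"

lemma total_superset:
  "finite A \<Longrightarrow> Poly_Mapping.keys f \<subseteq> A \<Longrightarrow> total f = (\<Sum>i\<in>A. Poly_Mapping.lookup f i)"
  unfolding total_def
  by (intro sum.mono_neutral_left) (auto simp: not_in_keys_iff_lookup_eq_zero)

lemma total_add: "total (f + g) = total f + total g"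
proof -
  let ?A = "Poly_Mapping.keys f \<union> Poly_Mapping.keys g"
  have "total (f + g) = (\<Sum>i\<in>?A. Poly_Mapping.lookup (f + g) i)"
    by (rule total_superset) (auto simp: Poly_Mapping.keys_add)
  then show ?thesis by (simp add: lookup_add sum.distrib total_superset[of ?A])
qed

lemma total_0: "total 0 = 0"
  by (simp add: total_def)

lemma total_sum: "total (\<Sum>i\<in>I. f i) = (\<Sum>i\<in>I. total (f i))"
  by (induction I rule: infinite_finite_induct) (auto simp: total_0 total_add)

lemma total_pure_tensor [simp]: "total (pure_tensor x \<alpha>) = x"
  by (auto simp: total_def pure_tensor_def)

lemma lookup_map_zero:
  "h 0 = 0 \<Longrightarrow> Poly_Mapping.lookup (Poly_Mapping.map h f) i = h (Poly_Mapping.lookup f i)"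
  by (simp add: Poly_Mapping.map.rep_eq when_def)

text \<open>Additivity carries \<open>h\<close> through the finite sum. Entries killed by
  \<open>h\<close> leave the support, so the sum is kept over the old one. The lemma is applied to
  attaching a label, to reading off one coefficient and to scaling.\<close>

lemma total_map:
  assumes "h 0 = 0" "\<And>x y. h (x + y) = h x + h y"
  shows "total (Poly_Mapping.map h f) = h (total f)"
proof -
  have "total (Poly_Mapping.map h f) = (\<Sum>i\<in>Poly_Mapping.keys f. h (Poly_Mapping.lookup f i))"
    by (subst total_superset[of "Poly_Mapping.keys f"])
      (auto simp: lookup_map_zero assms in_keys_iff intro!: sum.cong)
  also have "\<dots> = h (total f)"
    unfolding total_def using sum_comp_morphism[of h, OF assms] by (simp add: o_def)
  finally show ?thesis .
qed

section \<open>Pure tensors, the label-forgetting map and the grading on the tensor product\<close>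

lemma pure_tensor_0 [simp]: "pure_tensor 0 \<alpha> = 0"
  by (simp add: pure_tensor_def)

lemma pure_tensor_add: "pure_tensor (x + y) \<alpha> = pure_tensor x \<alpha> + pure_tensor y \<alpha>"
  by (simp add: pure_tensor_def single_add)

lemma pure_tensor_sum: "pure_tensor (\<Sum>i\<in>I. x i) \<alpha> = (\<Sum>i\<in>I. pure_tensor (x i) \<alpha>)"
  by (induction I rule: infinite_finite_induct) (auto simp: pure_tensor_add)

lemma keys_pure_tensor: "Poly_Mapping.keys (pure_tensor x \<alpha>) \<subseteq> {\<alpha>}"
  by (auto simp: pure_tensor_def)

lemma lookup_pure_tensor:
  "Poly_Mapping.lookup (pure_tensor x \<alpha>) \<beta> = (if \<alpha> = \<beta> then x else 0)"
  by (simp add: pure_tensor_def lookup_single when_def)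

context vector_space
begin

lemma pure_tensor_scale: "pure_tensor (scale c x) \<alpha> = tensor_scale scale c (pure_tensor x \<alpha>)"
  by (rule poly_mapping_eqI) (simp add: lookup_tensor_scale lookup_pure_tensor)

lemma linear_pure_tensor:
  "Vector_Spaces.linear scale (tensor_scale scale) (\<lambda>x. pure_tensor x \<alpha>)"
  using vector_space_axioms vector_space_tensor
  by (simp add: Vector_Spaces.linear_iff pure_tensor_add pure_tensor_scale)

lemma total_scale: "total (tensor_scale scale c f) = scale c (total f)"
  by (simp add: tensor_scale_def total_map scale_right_distrib)

lemma linear_total: "Vector_Spaces.linear (tensor_scale scale) scale total"
  using vector_space_axioms vector_space_tensor
  by (simp add: Vector_Spaces.linear_iff total_add total_scale)

end

text \<open>The grading is inherited coefficient by coefficient: existence by decomposing every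
  coefficient and reattaching its label, uniqueness by comparing decompositions at each
  label.\<close>

lemma graded_space_tensor:
  fixes s :: "'k::field \<Rightarrow> 'd::ab_group_add \<Rightarrow> 'd"
  assumes "graded_space s D"
  shows "graded_space (tensor_scale s :: 'k \<Rightarrow> ('w \<Rightarrow>\<^sub>0 'd) \<Rightarrow> _) (tensor_grading D)"
proof -
  interpret D: vector_space s using assms by (simp add: graded_space_def)
  interpret T: vector_space "tensor_scale s :: 'k \<Rightarrow> ('w \<Rightarrow>\<^sub>0 'd) \<Rightarrow> _" by (rule D.vector_space_tensor)
  have sub: "D.subspace (D d)" for d using assms by (simp add: graded_space_def)
  have ex1: "\<exists>!f. (\<forall>d. Poly_Mapping.lookup f d \<in> D d) \<and> x = total f" for x
    using assms by (simp add: graded_space_def total_def)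
  then have "\<forall>x. \<exists>f. (\<forall>d. Poly_Mapping.lookup f d \<in> D d) \<and> x = total f" by blast
  then obtain c where c: "Poly_Mapping.lookup (c x) d \<in> D d" "total (c x) = x" for x d
    by metis
  have Tsub: "T.subspace (tensor_grading D d)" for d
    using sub by (intro T.subspaceI)
      (auto simp: tensor_grading_def lookup_add D.lookup_tensor_scale
        D.subspace_0 D.subspace_add D.subspace_scale)
  have "\<exists>!g. (\<forall>d. Poly_Mapping.lookup g d \<in> tensor_grading D d) \<and> f = total g" for f :: "'w \<Rightarrow>\<^sub>0 'd"
  proof (rule ex_ex1I)
    \<comment> \<open>\<open>c\<close> picks the homogeneous components of a coefficient; each is
      put back at the label it came from.\<close>
    define g where "g = (\<Sum>\<alpha>\<in>Poly_Mapping.keys f.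
      Poly_Mapping.map (\<lambda>x. pure_tensor x \<alpha>) (c (Poly_Mapping.lookup f \<alpha>)))"
    have "total g = (\<Sum>\<alpha>\<in>Poly_Mapping.keys f. pure_tensor (Poly_Mapping.lookup f \<alpha>) \<alpha>)"
      by (simp add: g_def total_sum total_map pure_tensor_add c)
    then have "total g = f" by (simp flip: poly_mapping_as_sum)
    moreover have "Poly_Mapping.lookup g d \<in> tensor_grading D d" for d
      unfolding g_def lookup_sum
      by (intro T.subspace_sum Tsub)
        (auto simp: lookup_map_zero tensor_grading_def lookup_pure_tensor c D.subspace_0[OF sub])
    ultimately show "\<exists>g. (\<forall>d. Poly_Mapping.lookup g d \<in> tensor_grading D d) \<and> f = total g" by metis
  next
    fix g g' :: "int \<Rightarrow>\<^sub>0 ('w \<Rightarrow>\<^sub>0 'd)"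
    assume g: "(\<forall>d. Poly_Mapping.lookup g d \<in> tensor_grading D d) \<and> f = total g"
      and g': "(\<forall>d. Poly_Mapping.lookup g' d \<in> tensor_grading D d) \<and> f = total g'"
    \<comment> \<open>Reading a decomposition at one label gives a decomposition of the coefficient
      there, and that one is unique in the given space.\<close>
    define coef :: "'w \<Rightarrow> (int \<Rightarrow>\<^sub>0 ('w \<Rightarrow>\<^sub>0 'd)) \<Rightarrow> (int \<Rightarrow>\<^sub>0 'd)"
      where "coef \<alpha> = Poly_Mapping.map (\<lambda>p. Poly_Mapping.lookup p \<alpha>)" for \<alpha>
    have lk: "Poly_Mapping.lookup (coef \<alpha> q) d = Poly_Mapping.lookup (Poly_Mapping.lookup q d) \<alpha>"
      for \<alpha> d and q :: "int \<Rightarrow>\<^sub>0 ('w \<Rightarrow>\<^sub>0 'd)"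
      by (simp add: coef_def lookup_map_zero)
    have "coef \<alpha> g = coef \<alpha> g'" for \<alpha>
    proof -
      have "(\<forall>d. Poly_Mapping.lookup (coef \<alpha> q) d \<in> D d) \<and> Poly_Mapping.lookup f \<alpha> = total (coef \<alpha> q)"
        if "(\<forall>d. Poly_Mapping.lookup q d \<in> tensor_grading D d) \<and> f = total q" for q
        using that by (auto simp: lk tensor_grading_def) (simp add: coef_def total_map lookup_add)
      from ex1[of "Poly_Mapping.lookup f \<alpha>"] this[OF g] this[OF g'] show ?thesis by blast
    qed
    then show "g = g'" by (metis lk poly_mapping_eqI)
  qed
  then show ?thesis
    using T.vector_space_axioms Tsub by (simp add: graded_space_def flip: total_def)
qed

section \<open>The dendriform operations on the tensor product\<close>

lemma homogeneous_lookup: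
  assumes "homogeneous (tensor_grading D) ds fs" "length \<alpha>s = length fs"
  shows "homogeneous D ds (map2 Poly_Mapping.lookup fs \<alpha>s)"
  using assms by (auto simp: homogeneous_def list_all2_conv_all_nth tensor_grading_def)

section \<open>Expansion of multilinear maps in pure tensors\<close>

lemma linear_in_head:
  "multilinear s s' (Suc n) F \<Longrightarrow> length fs = n \<Longrightarrow> Vector_Spaces.linear s s' (\<lambda>f. F (f # fs))"
  \<comment> \<open>The head \<open>undefined\<close> is only a placeholder overwritten by the
    update at index 0.\<close>
  using multilinearD[of s s' "Suc n" F "undefined # fs" 0] by simp

lemma multilinear_tail:
  fixes F :: "'v::ab_group_add list \<Rightarrow> 'u::ab_group_add"
  assumes "multilinear s s' (Suc n) F"
  shows "multilinear s s' n (\<lambda>fs. F (f # fs))"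
  unfolding multilinear_def
proof (intro allI impI)
  fix xs :: "'v list" and j
  assume "length xs = n" "j < n"
  then have "Vector_Spaces.linear s s' (\<lambda>x. F ((f # xs)[Suc j := x]))"
    by (intro multilinearD[OF assms]) auto
  then show "Vector_Spaces.linear s s' (\<lambda>x. F (f # xs[j := x]))" by simp
qed

text \<open>Expand the first argument over its support, then apply induction to the map with that
  argument fixed. It reduces identities between multilinear maps to pure tensors.\<close>

lemma multilinear_expand:
  fixes fs :: "('w \<Rightarrow>\<^sub>0 'd::ab_group_add) list"
  assumes "multilinear (tensor_scale s) s' n F" "length fs = n"
  shows "F fs = (\<Sum>\<alpha>s\<in>listset (map Poly_Mapping.keys fs).
    F (map2 pure_tensor (map2 Poly_Mapping.lookup fs \<alpha>s) \<alpha>s))"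
  using assms
proof (induction fs arbitrary: n F)
  case (Cons f fs)
  then obtain m where n: "n = Suc m" "length fs = m" by (cases n) auto
  let ?p = "\<lambda>\<alpha>. pure_tensor (Poly_Mapping.lookup f \<alpha>) \<alpha>"
  have "F (f # fs) = F ((\<Sum>\<alpha>\<in>Poly_Mapping.keys f. ?p \<alpha>) # fs)"
    by (simp flip: poly_mapping_as_sum)
  also have "\<dots> = (\<Sum>\<alpha>\<in>Poly_Mapping.keys f. F (?p \<alpha> # fs))"
    using Cons.prems n by (intro linear_setsum[of _ _ "\<lambda>f. F (f # fs)"] linear_in_head) auto
  also have "\<dots> = (\<Sum>\<alpha>\<in>Poly_Mapping.keys f. \<Sum>\<alpha>s\<in>listset (map Poly_Mapping.keys fs).
      F (?p \<alpha> # map2 pure_tensor (map2 Poly_Mapping.lookup fs \<alpha>s) \<alpha>s))"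
  proof (rule sum.cong[OF refl])
    fix \<alpha>
    have "multilinear (tensor_scale s) s' m (\<lambda>gs. F (?p \<alpha> # gs))"
      using Cons.prems n multilinear_tail[of _ _ m F] by simp
    from Cons.IH[OF this n(2)] show "F (?p \<alpha> # fs) = (\<Sum>\<alpha>s\<in>listset (map Poly_Mapping.keys fs).
      F (?p \<alpha> # map2 pure_tensor (map2 Poly_Mapping.lookup fs \<alpha>s) \<alpha>s))" .
  qed
  finally show ?case by (simp add: sum_set_Cons)
qed simp

section \<open>The operations \<open>theta_bar\<close> of a fixed family algebra\<close>

locale dend_inf_family =
  fixes s :: "'k::field \<Rightarrow> 'd::ab_group_add \<Rightarrow> 'd"
    and D :: "int \<Rightarrow> 'd set"
    and \<theta> :: "nat \<Rightarrow> nat \<Rightarrow> 'w::semigroup_mult list \<Rightarrow> 'd list \<Rightarrow> 'd"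
  assumes dend: "dend_inf_family_algebra s D \<theta>"
begin

lemma graded: "graded_space s D"
  using dend unfolding dend_inf_family_algebra_def by (rule conjunct1)

sublocale vector_space s
  using graded by (simp add: graded_space_def)

sublocale T: vector_space "tensor_scale s :: 'k \<Rightarrow> ('w \<Rightarrow>\<^sub>0 'd) \<Rightarrow> _"
  by (rule vector_space_tensor)

lemma graded_tensor: "graded_space (tensor_scale s :: 'k \<Rightarrow> ('w \<Rightarrow>\<^sub>0 'd) \<Rightarrow> _) (tensor_grading D)"
  by (rule graded_space_tensor) (rule graded)

lemma subspace_grading: "subspace (D d)"
  using graded by (simp add: graded_space_def)

lemma subspace_tensor_grading: "T.subspace (tensor_grading D d)"
  using graded_tensor by (simp add: graded_space_def)

lemma theta_properties:
  assumes "r \<in> {1..k}" "length \<alpha>s = k"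
  shows theta_multilinear: "multilinear s s k (\<theta> k r \<alpha>s)"
    and theta_degree: "degree_one D D k (\<theta> k r \<alpha>s)"
    and theta_label: "length xs = k \<Longrightarrow> \<theta> k r (\<alpha>s[r - 1 := \<beta>]) xs = \<theta> k r \<alpha>s xs"
proof -
  have "\<forall>k\<ge>1. \<forall>r\<in>{1..k}. \<forall>\<alpha>s. length \<alpha>s = k \<longrightarrow>
      multilinear s s k (\<theta> k r \<alpha>s) \<and> degree_one D D k (\<theta> k r \<alpha>s) \<and>
      (\<forall>\<beta> xs. length xs = k \<longrightarrow> \<theta> k r (\<alpha>s[r - 1 := \<beta>]) xs = \<theta> k r \<alpha>s xs)"
    using dend unfolding dend_inf_family_algebra_def by (elim conjE)
  moreover have "k \<ge> 1" using assms by auto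
  ultimately have "multilinear s s k (\<theta> k r \<alpha>s) \<and> degree_one D D k (\<theta> k r \<alpha>s) \<and>
      (\<forall>\<beta> xs. length xs = k \<longrightarrow> \<theta> k r (\<alpha>s[r - 1 := \<beta>]) xs = \<theta> k r \<alpha>s xs)"
    using assms by blast
  then show "multilinear s s k (\<theta> k r \<alpha>s)" "degree_one D D k (\<theta> k r \<alpha>s)"
    "length xs = k \<Longrightarrow> \<theta> k r (\<alpha>s[r - 1 := \<beta>]) xs = \<theta> k r \<alpha>s xs"
    by blast+
qed

lemma theta_identity:
  assumes "r \<in> {1..n}" "length \<alpha>s = n" "length xs = n" "homogeneous D ds xs"
  shows "(\<Sum>k=1..n. \<Sum>i=1..k.
    s (insertion_sign i ds) (dend_family_comp \<theta> k (n + 1 - k) i r \<alpha>s xs)) = 0"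
proof -
  have "\<forall>n\<ge>1. \<forall>r\<in>{1..n}. \<forall>\<alpha>s ds xs.
      length \<alpha>s = n \<longrightarrow> length xs = n \<longrightarrow> homogeneous D ds xs \<longrightarrow>
      (\<Sum>k=1..n. \<Sum>i=1..k.
        s (insertion_sign i ds) (dend_family_comp \<theta> k (n + 1 - k) i r \<alpha>s xs)) = 0"
    using dend unfolding dend_inf_family_algebra_def by (elim conjE)
  moreover have "n \<ge> 1" using assms(1) by auto
  ultimately show ?thesis using assms by blast
qed

text \<open>A label outside the support of its argument contributes a zero coefficient, and
  multilinearity kills the summand. The index sets may therefore be enlarged to make different
  arguments comparable.\<close>

lemma theta_bar_superset:
  assumes r: "r \<in> {1..k}" and len: "length fs = k" "length As = k"
    and As: "\<And>j. j < k \<Longrightarrow> finite (As ! j)" "\<And>j. j < k \<Longrightarrow> Poly_Mapping.keys (fs ! j) \<subseteq> As ! j"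
  shows "theta_bar \<theta> k r fs = (\<Sum>\<alpha>s\<in>listset As.
    pure_tensor (\<theta> k r \<alpha>s (map2 Poly_Mapping.lookup fs \<alpha>s)) (label_prod \<alpha>s))"
  unfolding theta_bar_def
proof (rule sum.mono_neutral_left)
  show "finite (listset As)"
    using As(1) len by (intro finite_listset) (auto simp: in_set_conv_nth)
  show "listset (map Poly_Mapping.keys fs) \<subseteq> listset As"
    using len by (auto simp: listset_iff list_all2_conv_all_nth intro!: subsetD[OF As(2)])
  show "\<forall>\<alpha>s\<in>listset As - listset (map Poly_Mapping.keys fs).
    pure_tensor (\<theta> k r \<alpha>s (map2 Poly_Mapping.lookup fs \<alpha>s)) (label_prod \<alpha>s) = 0"
  proof
    fix \<alpha>s assume \<alpha>s: "\<alpha>s \<in> listset As - listset (map Poly_Mapping.keys fs)"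
    then have l: "length \<alpha>s = k" using len by (auto simp: listset_iff dest: list_all2_lengthD)
    from \<alpha>s l len obtain j where j: "j < k" "\<alpha>s ! j \<notin> Poly_Mapping.keys (fs ! j)"
      by (auto simp: listset_iff list_all2_conv_all_nth)
    then have "\<theta> k r \<alpha>s (map2 Poly_Mapping.lookup fs \<alpha>s) = 0"
      using l len by (intro multilinear_zero_arg[OF theta_multilinear[OF r l], of _ j])
        (auto simp: not_in_keys_iff_lookup_eq_zero)
    then show "pure_tensor (\<theta> k r \<alpha>s (map2 Poly_Mapping.lookup fs \<alpha>s)) (label_prod \<alpha>s) = 0"
      by simp
  qed
qed

lemma theta_bar_pure:
  assumes "r \<in> {1..k}" "length xs = k" "length \<alpha>s = k"
  shows "theta_bar \<theta> k r (map2 pure_tensor xs \<alpha>s) = pure_tensor (\<theta> k r \<alpha>s xs) (label_prod \<alpha>s)"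
proof -
  have "theta_bar \<theta> k r (map2 pure_tensor xs \<alpha>s) =
    (\<Sum>\<beta>s\<in>listset (map (\<lambda>\<alpha>. {\<alpha>}) \<alpha>s). pure_tensor
      (\<theta> k r \<beta>s (map2 Poly_Mapping.lookup (map2 pure_tensor xs \<alpha>s) \<beta>s)) (label_prod \<beta>s))"
    using assms by (intro theta_bar_superset) (auto dest: subsetD[OF keys_pure_tensor])
  moreover have "map2 Poly_Mapping.lookup (map2 pure_tensor xs \<alpha>s) \<alpha>s = xs"
    using assms by (intro nth_equalityI) (auto simp: lookup_pure_tensor)
  ultimately show ?thesis by (simp add: listset_singletons)
qed

lemma theta_bar_multilinear:
  assumes r: "r \<in> {1..k}"
  shows "multilinear (tensor_scale s) (tensor_scale s) k (theta_bar \<theta> k r)"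
  unfolding multilinear_def
proof (intro allI impI)
  fix fs :: "('w \<Rightarrow>\<^sub>0 'd) list" and j assume len: "length fs = k" and j: "j < k"
  \<comment> \<open>The set \<open>A\<close> replaces the support of the varied argument. Taking one
    \<open>A\<close> for two arguments and their sum, or for an argument and its multiple, lets
    linearity be checked summand by summand.\<close>
  have rep: "theta_bar \<theta> k r (fs[j := h]) = (\<Sum>\<alpha>s\<in>listset ((map Poly_Mapping.keys fs)[j := A]).
      pure_tensor (\<theta> k r \<alpha>s ((map2 Poly_Mapping.lookup fs \<alpha>s)[j := Poly_Mapping.lookup h (\<alpha>s ! j)])) (label_prod \<alpha>s))"
    if "finite A" "Poly_Mapping.keys h \<subseteq> A" for h A
  proof -
    have "map2 Poly_Mapping.lookup (fs[j := h]) \<alpha>s =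
        (map2 Poly_Mapping.lookup fs \<alpha>s)[j := Poly_Mapping.lookup h (\<alpha>s ! j)]"
      if "length \<alpha>s = k" for \<alpha>s
      using map2_list_update[of fs \<alpha>s Poly_Mapping.lookup j h "\<alpha>s ! j"] len that
      by (simp only: list_update_id)
    moreover have "length \<alpha>s = k" if "\<alpha>s \<in> listset ((map Poly_Mapping.keys fs)[j := A])" for \<alpha>s
      using that len by (auto simp: listset_iff dest: list_all2_lengthD)
    moreover have "theta_bar \<theta> k r (fs[j := h]) = (\<Sum>\<alpha>s\<in>listset ((map Poly_Mapping.keys fs)[j := A]).
      pure_tensor (\<theta> k r \<alpha>s (map2 Poly_Mapping.lookup (fs[j := h]) \<alpha>s)) (label_prod \<alpha>s))"
      using len j r that by (intro theta_bar_superset) (auto simp: nth_list_update)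
    ultimately show ?thesis by simp
  qed
  have lin: "Vector_Spaces.linear s s (\<lambda>x. \<theta> k r \<alpha>s ((map2 Poly_Mapping.lookup fs \<alpha>s)[j := x]))"
    if "\<alpha>s \<in> listset ((map Poly_Mapping.keys fs)[j := A])" for \<alpha>s A
  proof -
    have "length \<alpha>s = k" using that len by (auto simp: listset_iff dest: list_all2_lengthD)
    then show ?thesis using len j by (intro multilinearD[OF theta_multilinear[OF r]]) auto
  qed
  show "Vector_Spaces.linear (tensor_scale s) (tensor_scale s) (\<lambda>f. theta_bar \<theta> k r (fs[j := f]))"
    unfolding Vector_Spaces.linear_iff
  proof (intro conjI allI T.vector_space_axioms)
    fix f g :: "'w \<Rightarrow>\<^sub>0 'd"
    let ?A = "Poly_Mapping.keys f \<union> Poly_Mapping.keys g"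
    have fin: "finite ?A" by simp
    show "theta_bar \<theta> k r (fs[j := f + g]) = theta_bar \<theta> k r (fs[j := f]) + theta_bar \<theta> k r (fs[j := g])"
      unfolding rep[OF fin Poly_Mapping.keys_add] rep[OF fin Un_upper1] rep[OF fin Un_upper2]
        sum.distrib[symmetric] lookup_add
      using lin by (intro sum.cong refl) (simp add: Vector_Spaces.linear_iff pure_tensor_add)
  next
    fix c and f :: "'w \<Rightarrow>\<^sub>0 'd"
    have sub: "Poly_Mapping.keys (tensor_scale s c f) \<subseteq> Poly_Mapping.keys f"
      by (auto simp: in_keys_iff lookup_tensor_scale)
    show "theta_bar \<theta> k r (fs[j := tensor_scale s c f]) = tensor_scale s c (theta_bar \<theta> k r (fs[j := f]))"
      unfolding rep[OF finite_keys sub] rep[OF finite_keys order_refl[of "Poly_Mapping.keys f"]] lookup_tensor_scale T.scale_sum_right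
      using lin by (intro sum.cong refl) (simp add: Vector_Spaces.linear_iff pure_tensor_scale)
  qed
qed

text \<open>Labels have degree 0, so the degree is checked on the coefficients.\<close>

lemma theta_bar_degree:
  assumes r: "r \<in> {1..k}"
  shows "degree_one (tensor_grading D) (tensor_grading D) k (theta_bar \<theta> k r)"
  unfolding degree_one_def theta_bar_def
proof (intro allI impI T.subspace_sum subspace_tensor_grading)
  fix ds and fs :: "('w \<Rightarrow>\<^sub>0 'd) list" and \<alpha>s
  assume len: "length fs = k" and hom: "homogeneous (tensor_grading D) ds fs"
    and "\<alpha>s \<in> listset (map Poly_Mapping.keys fs)"
  then have l: "length \<alpha>s = k" by (auto simp: listset_iff dest: list_all2_lengthD)
  have "\<theta> k r \<alpha>s (map2 Poly_Mapping.lookup fs \<alpha>s) \<in> D (sum_list ds + 1)"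
    using theta_degree[OF r l] homogeneous_lookup[OF hom, of \<alpha>s] l len by (auto simp: degree_one_def)
  then show "pure_tensor (\<theta> k r \<alpha>s (map2 Poly_Mapping.lookup fs \<alpha>s)) (label_prod \<alpha>s)
      \<in> tensor_grading D (sum_list ds + 1)"
    by (auto simp: tensor_grading_def lookup_pure_tensor subspace_0[OF subspace_grading])
qed

section \<open>The dendriform identities on the tensor product\<close>

lemma dend_comp_multilinear:
  assumes "k + l = n + 1" "1 \<le> i" "i \<le> k" "1 \<le> l" "r \<in> {1..n}"
  shows "multilinear (tensor_scale s) (tensor_scale s) n (dend_comp (theta_bar \<theta>) k l i r)"
proof -
  have sum: "multilinear (tensor_scale s) (tensor_scale s) l (\<lambda>fs. \<Sum>q=1..l. theta_bar \<theta> l q fs)"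
    by (intro multilinear_sum T.vector_space_axioms theta_bar_multilinear)
  \<comment> \<open>Every branch of \<open>dend_comp\<close> is such an insertion: \<open>G\<close>
    is the sum of all inner operations or a single one of them.\<close>
  have ins: "multilinear (tensor_scale s) (tensor_scale s) n
      (\<lambda>fs. theta_bar \<theta> k q (contract i l fs (G (block i l fs))))"
    if "q \<in> {1..k}" "multilinear (tensor_scale s) (tensor_scale s) l G" for q G
    using assms that by (intro multilinear_insertion[where k = k and l = l] theta_bar_multilinear) auto
  consider "r < i" | "i \<le> r" "r < i + l" | "i + l \<le> r" by linarith
  then show ?thesis
  proof cases
    case 1
    then have "r \<in> {1..k}" using assms by auto
    from ins[OF this sum] 1 show ?thesis by (simp add: dend_comp_def[abs_def])
  next
    case 2
    then have "r - i + 1 \<in> {1..l}" by auto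
    from ins[OF _ theta_bar_multilinear[OF this], of i] 2 assms show ?thesis
      by (simp add: dend_comp_def[abs_def])
  next
    case 3
    then have "r - l + 1 \<in> {1..k}" using assms by auto
    from ins[OF this sum] 3 show ?thesis by (simp add: dend_comp_def[abs_def])
  qed
qed

text \<open>The inner operation multiplies the labels of its block and the outer one the contracted
  labels. By associativity the final label is the full product for every \<open>k\<close> and
  \<open>i\<close>.\<close>

lemma dend_comp_pure:
  assumes "k + l = n + 1" "1 \<le> i" "i \<le> k" "1 \<le> l" "r \<in> {1..n}"
    and len: "length xs = n" "length \<alpha>s = n"
  shows "dend_comp (theta_bar \<theta>) k l i r (map2 pure_tensor xs \<alpha>s) =
    pure_tensor (dend_family_comp \<theta> k l i r \<alpha>s xs) (label_prod \<alpha>s)"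
proof -
  let ?\<beta> = "label_prod (block i l \<alpha>s)"
  have il: "i + l \<le> length xs + 1" "i + l \<le> length \<alpha>s + 1" using assms by auto
  have inner: "theta_bar \<theta> l q (block i l (map2 pure_tensor xs \<alpha>s)) =
      pure_tensor (\<theta> l q (block i l \<alpha>s) (block i l xs)) ?\<beta>" if "q \<in> {1..l}" for q
    using that assms il by (simp only: map2_block[symmetric] theta_bar_pure length_block)
  have inner_sum: "(\<Sum>q=1..l. theta_bar \<theta> l q (block i l (map2 pure_tensor xs \<alpha>s))) =
      pure_tensor (\<Sum>q=1..l. \<theta> l q (block i l \<alpha>s) (block i l xs)) ?\<beta>"
    unfolding pure_tensor_sum by (intro sum.cong refl inner)
  have outer: "theta_bar \<theta> k q (contract i l (map2 pure_tensor xs \<alpha>s) (pure_tensor y ?\<beta>)) =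
      pure_tensor (\<theta> k q (contract i l \<alpha>s ?\<beta>) (contract i l xs y)) (label_prod \<alpha>s)"
    if "q \<in> {1..k}" for q y
  proof -
    have "length (contract i l xs y) = k" "length (contract i l \<alpha>s ?\<beta>) = k"
      using assms il by (simp_all add: length_contract)
    moreover have "contract i l (map2 pure_tensor xs \<alpha>s) (pure_tensor y ?\<beta>) =
        map2 pure_tensor (contract i l xs y) (contract i l \<alpha>s ?\<beta>)"
      using len by (simp add: map2_contract)
    moreover have "label_prod (contract i l \<alpha>s ?\<beta>) = label_prod \<alpha>s"
      using assms il by (intro label_prod_contract) auto
    ultimately show ?thesis using theta_bar_pure[OF that] by simp
  qed
  consider "r < i" | "i \<le> r" "r < i + l" | "i + l \<le> r" by linarith
  then show ?thesis
  proof cases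
    case 1
    then show ?thesis
      using assms unfolding dend_comp_def dend_family_comp_def Let_def inner_sum by (simp add: outer)
  next
    case 2
    then have "r - i + 1 \<in> {1..l}" by auto
    from inner[OF this] 2 show ?thesis
      using assms unfolding dend_comp_def dend_family_comp_def Let_def by (simp add: outer)
  next
    case 3
    then have "r - l + 1 \<in> {1..k}" using assms by auto
    with 3 show ?thesis
      using assms outer[of "r - l + 1"] unfolding dend_comp_def dend_family_comp_def Let_def inner_sum
      by simp
  qed
qed

text \<open>The signs depend on the fixed degree list \<open>ds\<close> and not on the arguments, so
  the left-hand side is multilinear in arbitrary arguments and may be expanded. The coefficients of
  the expansion keep the degrees \<open>ds\<close>.\<close>

lemma theta_bar_identity:
  assumes r: "r \<in> {1..n}" and len: "length fs = n" and hom: "homogeneous (tensor_grading D) ds fs"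
  shows "(\<Sum>k=1..n. \<Sum>i=1..k. tensor_scale s (insertion_sign i ds)
    (dend_comp (theta_bar \<theta>) k (n + 1 - k) i r fs)) = 0" (is "?F fs = 0")
proof -
  have "multilinear (tensor_scale s) (tensor_scale s) n ?F"
    using r by (intro multilinear_sum multilinear_scaled dend_comp_multilinear T.vector_space_axioms) auto
  then have "?F fs = (\<Sum>\<alpha>s\<in>listset (map Poly_Mapping.keys fs).
      ?F (map2 pure_tensor (map2 Poly_Mapping.lookup fs \<alpha>s) \<alpha>s))"
    using len by (rule multilinear_expand)
  also have "\<dots> = 0"
  proof (rule sum.neutral, rule ballI)
    fix \<alpha>s assume "\<alpha>s \<in> listset (map Poly_Mapping.keys fs)"
    then have l: "length \<alpha>s = n" using len by (auto simp: listset_iff dest: list_all2_lengthD)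
    let ?xs = "map2 Poly_Mapping.lookup fs \<alpha>s"
    \<comment> \<open>All terms now share one label, so the double sum is the identity of the given
      family tensored with that label.\<close>
    have "?F (map2 pure_tensor ?xs \<alpha>s) = (\<Sum>k=1..n. \<Sum>i=1..k. pure_tensor
        (s (insertion_sign i ds) (dend_family_comp \<theta> k (n + 1 - k) i r \<alpha>s ?xs)) (label_prod \<alpha>s))"
      unfolding pure_tensor_scale using r l len
      by (intro sum.cong refl arg_cong[where f = "tensor_scale s _"] dend_comp_pure) auto
    also have "\<dots> = 0"
      unfolding pure_tensor_sum[symmetric]
      using theta_identity[OF r l, of ?xs ds] homogeneous_lookup[OF hom, of \<alpha>s] l len by simp
    finally show "?F (map2 pure_tensor ?xs \<alpha>s) = 0" .
  qed
  finally show ?thesis .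
qed

lemma dend_inf_algebra_theta_bar:
  "dend_inf_algebra (tensor_scale s) (tensor_grading D) (theta_bar \<theta>)"
  unfolding dend_inf_algebra_def
  using graded_tensor theta_bar_multilinear theta_bar_degree theta_bar_identity by blast


section \<open>The homotopy associative algebra\<close>

lemma mu_tensor_eq: "mu_tensor \<theta> k fs = (\<Sum>r=1..k. theta_bar \<theta> k r fs)"
  unfolding mu_tensor_def theta_bar_def by (rule sum.swap)

lemma mu_tensor_pure:
  "length xs = k \<Longrightarrow> length \<alpha>s = k \<Longrightarrow>
    mu_tensor \<theta> k (map2 pure_tensor xs \<alpha>s) = (\<Sum>r=1..k. pure_tensor (\<theta> k r \<alpha>s xs) (label_prod \<alpha>s))"
  unfolding mu_tensor_eq by (intro sum.cong refl theta_bar_pure)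

end

text \<open>The three ranges are the branches of a dendriform composition, the last two reindexed:
  by the inner index in the block and by the outer index behind it.\<close>

lemma sum_split_block:
  fixes i l n :: nat
  assumes "k + l = n + 1" "1 \<le> i" "i \<le> k" "1 \<le> l"
  shows "(\<Sum>r=1..n. g r) =
    (\<Sum>r\<in>{1..<i}. g r) + (\<Sum>q=1..l. g (i + q - 1)) + (\<Sum>q\<in>{i<..k}. g (q + l - 1))"
proof -
  have "{1..n} = {1..<i} \<union> {i..<i + l} \<union> {i + l..n}" using assms by auto
  then have "(\<Sum>r=1..n. g r) = (\<Sum>r\<in>{1..<i}. g r) + (\<Sum>r\<in>{i..<i + l}. g r) + (\<Sum>r\<in>{i + l..n}. g r)"
    by (simp only:) (subst sum.union_disjoint; auto)+
  moreover have "(\<Sum>r\<in>{i..<i + l}. g r) = (\<Sum>q=1..l. g (i + q - 1))"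
    using assms by (intro sum.reindex_bij_witness[of _ "\<lambda>q. i + q - 1" "\<lambda>r. r - i + 1"]) auto
  moreover have "(\<Sum>r\<in>{i + l..n}. g r) = (\<Sum>q\<in>{i<..k}. g (q + l - 1))"
    using assms by (intro sum.reindex_bij_witness[of _ "\<lambda>q. q + l - 1" "\<lambda>r. r - l + 1"]) auto
  ultimately show ?thesis by simp
qed

text \<open>An outer index other than \<open>i\<close> comes from exactly one \<open>r\<close>, with
  the full inner sum inserted. The outer index \<open>i\<close> comes from \<open>l\<close> values
  of \<open>r\<close>, one for each inner operation, and linearity in that slot recombines them.
  Hence the dendriform identities add up to the associative one.\<close>

lemma sum_dend_comp:
  assumes "k + l = n + 1" "1 \<le> i" "i \<le> k" "1 \<le> l" and len: "length xs = n"
    and mult: "\<And>q. q \<in> {1..k} \<Longrightarrow> multilinear t t k (\<theta> k q)"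
  shows "(\<Sum>r=1..n. dend_comp \<theta> k l i r xs) =
    (\<Sum>q=1..k. \<theta> k q (contract i l xs (\<Sum>q=1..l. \<theta> l q (block i l xs))))"
proof -
  let ?y = "\<Sum>q=1..l. \<theta> l q (block i l xs)"
  have c: "length (contract i l xs y) = k" for y
    using assms by (simp add: length_contract)
  have slot: "\<theta> k i (contract i l xs ?y) = (\<Sum>q=1..l. \<theta> k i (contract i l xs (\<theta> l q (block i l xs))))"
  proof -
    have "Vector_Spaces.linear t t (\<lambda>y. \<theta> k i ((contract i l xs 0)[i - 1 := y]))"
      using assms by (intro multilinearD[OF mult] c) auto
    moreover have "(contract i l xs 0)[i - 1 := y] = contract i l xs y" for y
      using assms by (intro contract_update_slot) auto
    ultimately show ?thesis using linear_setsum[of t t] by auto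
  qed
  have "{1..k} = insert i ({1..<i} \<union> {i<..k})" using assms by auto
  then have "(\<Sum>q=1..k. \<theta> k q (contract i l xs ?y)) = \<theta> k i (contract i l xs ?y) +
      ((\<Sum>q\<in>{1..<i}. \<theta> k q (contract i l xs ?y)) + (\<Sum>q\<in>{i<..k}. \<theta> k q (contract i l xs ?y)))"
    by (simp only:) (subst sum.insert; (subst sum.union_disjoint)?; auto)
  moreover have "(\<Sum>r\<in>{1..<i}. dend_comp \<theta> k l i r xs) = (\<Sum>q\<in>{1..<i}. \<theta> k q (contract i l xs ?y))"
    by (intro sum.cong refl) (simp add: dend_comp_def)
  moreover have "(\<Sum>q=1..l. dend_comp \<theta> k l i (i + q - 1) xs) = \<theta> k i (contract i l xs ?y)"
    unfolding slot using assms by (intro sum.cong refl) (auto simp: dend_comp_def)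
  moreover have "(\<Sum>q\<in>{i<..k}. dend_comp \<theta> k l i (q + l - 1) xs) = (\<Sum>q\<in>{i<..k}. \<theta> k q (contract i l xs ?y))"
    using assms by (intro sum.cong refl) (auto simp: dend_comp_def)
  ultimately show ?thesis
    using sum_split_block[OF assms(1-4), of "\<lambda>r. dend_comp \<theta> k l i r xs"] by (simp add: add_ac)
qed

context dend_inf_family
begin

lemma mu_tensor_degree: "degree_one (tensor_grading D) (tensor_grading D) k (mu_tensor \<theta> k)"
  unfolding degree_one_def mu_tensor_eq
  using theta_bar_degree by (auto intro!: T.subspace_sum subspace_tensor_grading simp: degree_one_def)

lemma ainf_algebra_mu_tensor: "ainf_algebra (tensor_scale s) (tensor_grading D) (mu_tensor \<theta>)"
  unfolding ainf_algebra_def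
proof (intro conjI allI impI graded_tensor mu_tensor_degree)
  show "multilinear (tensor_scale s) (tensor_scale s) k (mu_tensor \<theta> k)" for k
    unfolding mu_tensor_eq[abs_def] by (intro multilinear_sum theta_bar_multilinear T.vector_space_axioms)
next
  fix n ds and fs :: "('w \<Rightarrow>\<^sub>0 'd) list"
  assume len: "length fs = n" and hom: "homogeneous (tensor_grading D) ds fs"
  have comp: "mu_tensor \<theta> k (contract i (n + 1 - k) fs (mu_tensor \<theta> (n + 1 - k) (block i (n + 1 - k) fs))) =
      (\<Sum>r=1..n. dend_comp (theta_bar \<theta>) k (n + 1 - k) i r fs)" if "k \<in> {1..n}" "i \<in> {1..k}" for k i
    unfolding mu_tensor_eq using that len
    by (intro sum_dend_comp[symmetric, where t = "tensor_scale s"] theta_bar_multilinear) auto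
  have "(\<Sum>k=1..n. \<Sum>i=1..k. tensor_scale s (insertion_sign i ds)
      (mu_tensor \<theta> k (contract i (n + 1 - k) fs (mu_tensor \<theta> (n + 1 - k) (block i (n + 1 - k) fs))))) =
    (\<Sum>k=1..n. \<Sum>i=1..k. tensor_scale s (insertion_sign i ds)
      (\<Sum>r=1..n. dend_comp (theta_bar \<theta>) k (n + 1 - k) i r fs))"
    by (intro sum.cong refl) (simp only: comp)
  \<comment> \<open>The sum over \<open>r\<close> is moved outside in two exchanges, leaving one
    vanishing dendriform identity for each \<open>r\<close>.\<close>
  also have "\<dots> = (\<Sum>k=1..n. \<Sum>r=1..n. \<Sum>i=1..k. tensor_scale s (insertion_sign i ds)
      (dend_comp (theta_bar \<theta>) k (n + 1 - k) i r fs))"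
    unfolding T.scale_sum_right by (rule sum.cong[OF refl], rule sum.swap)
  also have "\<dots> = (\<Sum>r=1..n. \<Sum>k=1..n. \<Sum>i=1..k. tensor_scale s (insertion_sign i ds)
      (dend_comp (theta_bar \<theta>) k (n + 1 - k) i r fs))"
    by (rule sum.swap)
  also have "\<dots> = 0"
    using theta_bar_identity[OF _ len hom] by simp
  finally show "(\<Sum>k=1..n. \<Sum>i=1..k. tensor_scale s (insertion_sign i ds)
      (mu_tensor \<theta> k (contract i (n + 1 - k) fs (mu_tensor \<theta> (n + 1 - k) (block i (n + 1 - k) fs))))) = 0" .
qed

end


section \<open>The representation\<close>

text \<open>The label \<open>undefined\<close> is the one that \<open>eta_tensor\<close> assigns to
  the module argument, which makes the two directly comparable.\<close>

definition embed :: "('w \<Rightarrow>\<^sub>0 'd::zero) + 'd \<Rightarrow> ('w \<Rightarrow>\<^sub>0 'd)" where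
  "embed z = (case z of Inl f \<Rightarrow> f | Inr x \<Rightarrow> pure_tensor x undefined)"

text \<open>Records membership in \<open>mixed_tensors\<close> together with the position, counted
  from 1, of the module entry. The pointwise form is easy to follow through blocks and
  contractions.\<close>

definition marked_at :: "nat \<Rightarrow> ('a + 'm) list \<Rightarrow> bool" where
  "marked_at r zs \<longleftrightarrow> r \<in> {1..length zs} \<and> (\<forall>j<length zs. isl (zs ! j) \<longleftrightarrow> j \<noteq> r - 1)"

lemma embed_simps [simp]: "embed (Inl f) = f" "embed (Inr x) = pure_tensor x undefined"
  by (simp_all add: embed_def)

lemma marked_atE:
  assumes "zs \<in> mixed_tensors k"
  obtains r where "marked_at r zs" "length zs = k"
proof -
  from assms obtain as u bs where zs: "zs = map Inl as @ Inr u # map Inl bs" "length zs = k"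
    by (auto simp: mixed_tensors_def)
  have "marked_at (length as + 1) zs"
    by (auto simp: marked_at_def zs(1) nth_append nth_Cons')
  then show thesis using that zs by blast
qed

lemma marked_at_list_update:
  "marked_at r zs \<Longrightarrow> j < length zs \<Longrightarrow> isl z = isl (zs ! j) \<Longrightarrow> marked_at r (zs[j := z])"
  by (auto simp: marked_at_def nth_list_update)

lemma marked_at_not_all_isl: "marked_at r zs \<Longrightarrow> \<not> (\<forall>z\<in>set zs. isl z)"
  by (auto simp: marked_at_def intro!: bexI[of _ "zs ! (r - 1)"])

lemma mixed_op_marked: "marked_at r zs \<Longrightarrow> mixed_op \<mu> \<eta> k zs = Inr (\<eta> k zs)"
  unfolding mixed_op_def by (rule if_not_P) (rule marked_at_not_all_isl)

text \<open>This is how \<open>eta_tensor\<close> finds the index of the operation to apply.\<close>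

lemma length_takeWhile_marked: "marked_at r zs \<Longrightarrow> length (takeWhile isl zs) + 1 = r"
proof -
  assume r: "marked_at r zs"
  then have "takeWhile isl zs = take (r - 1) zs"
    by (intro takeWhile_eq_take_P_nth) (auto simp: marked_at_def)
  then show ?thesis using r by (auto simp: marked_at_def)
qed

text \<open>All entries of a block that misses the module entry are tagged \<open>Inl\<close>, where
  \<open>projl\<close> and \<open>embed\<close> agree; so the inner operation is \<mu>.\<close>

lemma block_unmarked:
  assumes r: "marked_at r zs" and il: "1 \<le> i" "i + l \<le> length zs + 1" and out: "r < i \<or> i + l \<le> r"
  shows "mixed_op \<mu> \<eta> l (block i l zs) = Inl (\<mu> l (block i l (map embed zs)))"
proof -
  have isl: "\<forall>z\<in>set (block i l zs). isl z"
  proof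
    fix z assume "z \<in> set (block i l zs)"
    then obtain j where j: "j < l" "z = zs ! (i - 1 + j)"
      using il by (auto simp: in_set_conv_nth length_block nth_block)
    then have "i - 1 + j < length zs" "i - 1 + j \<noteq> r - 1" using il out r by (auto simp: marked_at_def)
    then show "isl z" using r j by (simp add: marked_at_def)
  qed
  have "map projl (block i l zs) = map embed (block i l zs)"
  proof (rule map_cong[OF refl])
    fix z assume "z \<in> set (block i l zs)"
    with isl show "projl z = embed z" by (cases z) auto
  qed
  then show ?thesis using isl by (simp add: mixed_op_def map_block)
qed

lemma marked_at_block:
  assumes "marked_at r zs" "1 \<le> i" "i + l \<le> length zs + 1" "i \<le> r" "r < i + l"
  shows "marked_at (r - i + 1) (block i l zs)"
proof -
  have "isl (block i l zs ! j) \<longleftrightarrow> j \<noteq> r - i" if "j < l" for j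
  proof -
    have "i - 1 + j < length zs" "i - 1 + j \<noteq> r - 1 \<longleftrightarrow> j \<noteq> r - i" using assms that by auto
    then show ?thesis using assms that by (simp add: nth_block marked_at_def)
  qed
  then show ?thesis using assms by (auto simp: marked_at_def length_block)
qed

text \<open>The new position \<open>q\<close> follows the three branches of
  \<open>dend_comp\<close>: it is exactly the index of the outer operation there. The result of the
  inner operation is a module element precisely when the block contains the old mark.\<close>

lemma marked_at_contract:
  assumes r: "marked_at r zs" and il: "1 \<le> i" "1 \<le> l" "i + l \<le> length zs + 1"
    and q: "q = (if r < i then r else if r < i + l then i else r - l + 1)"
    and z: "isl z \<longleftrightarrow> r < i \<or> i + l \<le> r"
  shows "marked_at q (contract i l zs z)"
proof -
  have len: "length (contract i l zs z) = length zs + 1 - l"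
    using il by (simp add: length_contract)
  have r': "1 \<le> r" "r \<le> length zs" and isl: "\<And>j. j < length zs \<Longrightarrow> isl (zs ! j) \<longleftrightarrow> j \<noteq> r - 1"
    using r by (auto simp: marked_at_def)
  have "isl (contract i l zs z ! j) \<longleftrightarrow> j \<noteq> q - 1" if j: "j < length zs + 1 - l" for j
  proof -
    consider "j < i - 1" | "j = i - 1" | "i - 1 < j" by linarith
    then show ?thesis
    proof cases
      case 1
      then have "isl (contract i l zs z ! j) \<longleftrightarrow> j \<noteq> r - 1"
        using il j isl[of j] by (simp add: nth_contract)
      also have "\<dots> \<longleftrightarrow> j \<noteq> q - 1" using 1 q il r' by (auto split: if_splits)
      finally show ?thesis .
    next
      case 2
      then have "isl (contract i l zs z ! j) \<longleftrightarrow> r < i \<or> i + l \<le> r"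
        using il j z by (simp add: nth_contract)
      also have "\<dots> \<longleftrightarrow> j \<noteq> q - 1" using 2 q il r' by (auto split: if_splits)
      finally show ?thesis .
    next
      case 3
      then have "isl (contract i l zs z ! j) \<longleftrightarrow> j + l - 1 \<noteq> r - 1"
        using il j isl[of "j + l - 1"] by (simp add: nth_contract)
      also have "\<dots> \<longleftrightarrow> j \<noteq> q - 1" using 3 q il r' by (auto split: if_splits)
      finally show ?thesis .
    qed
  qed
  moreover have "q \<in> {1..length zs + 1 - l}" using q il r' by (auto split: if_splits)
  ultimately show ?thesis by (auto simp: marked_at_def len)
qed

section \<open>Comparison of \<open>eta_tensor\<close> with \<open>theta_bar\<close> after
  forgetting labels\<close>

context dend_inf_family
begin

lemma theta_bar_linear:
  "r \<in> {1..k} \<Longrightarrow> length fs = k \<Longrightarrow> j < k \<Longrightarrow>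
    Vector_Spaces.linear (tensor_scale s) (tensor_scale s) (\<lambda>f. theta_bar \<theta> k r (fs[j := f]))"
  by (rule multilinearD[OF theta_bar_multilinear])

text \<open>
  As \<open>(\<theta>\<^sub>k)\<close> with superscript \<open>[r]\<close> ignores the \<open>r\<close>-th label, only the total of the \<open>r\<close>-th argument
  matters once the labels of the value are forgotten.
\<close>

lemma total_theta_bar_slot:
  assumes r: "r \<in> {1..k}" and len: "length fs = k"
  shows "total (theta_bar \<theta> k r (fs[r - 1 := pure_tensor (total (fs ! (r - 1))) \<beta>])) =
    total (theta_bar \<theta> k r fs)"
proof -
  define G where "G gs = total (theta_bar \<theta> k r gs)" for gs
  define F where "F gs = G (gs[r - 1 := pure_tensor (total (gs ! (r - 1))) \<beta>])" for gs
  have r1: "r - 1 < k" using r by auto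
  have G: "multilinear (tensor_scale s) s k G"
    unfolding G_def[abs_def] by (rule multilinear_comp_linear[OF theta_bar_multilinear[OF r] linear_total])
  have F: "multilinear (tensor_scale s) s k F"
    unfolding multilinear_def
  proof (intro allI impI)
    fix gs :: "('w \<Rightarrow>\<^sub>0 'd) list" and j assume gs: "length gs = k" and j: "j < k"
    show "Vector_Spaces.linear (tensor_scale s) s (\<lambda>f. F (gs[j := f]))"
    \<comment> \<open>Varying the \<open>r\<close>-th argument precomposes with the linear map that
      collapses all labels to \<beta>; varying another argument leaves the collapsed slot
      fixed.\<close>
    proof (cases "j = r - 1")
      case True
      have "Vector_Spaces.linear (tensor_scale s) (tensor_scale s) (\<lambda>f. pure_tensor (total f) \<beta>)"
        by (rule linear_comp[OF linear_total linear_pure_tensor])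
      from linear_comp[OF this multilinearD[OF G gs r1]] show ?thesis
        using True gs r1 by (simp add: F_def)
    next
      case False
      then show ?thesis
        using multilinearD[OF G _ j, of "gs[r - 1 := pure_tensor (total (gs ! (r - 1))) \<beta>]"] gs
        by (simp add: F_def list_update_swap)
    qed
  qed
  \<comment> \<open>On pure tensors \<open>F\<close> only changes the \<open>r\<close>-th label. The
    coefficient is unaffected by \<open>theta_label\<close>, and \<open>total\<close> ignores the
    changed label product.\<close>
  have "F (map2 pure_tensor xs \<alpha>s) = G (map2 pure_tensor xs \<alpha>s)"
    if l: "length xs = k" "length \<alpha>s = k" for xs \<alpha>s
  proof -
    have "(map2 pure_tensor xs \<alpha>s)[r - 1 := pure_tensor (xs ! (r - 1)) \<beta>] =
        map2 pure_tensor xs (\<alpha>s[r - 1 := \<beta>])"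
      using map2_list_update[of xs \<alpha>s pure_tensor "r - 1" "xs ! (r - 1)" \<beta>] l by (simp only: list_update_id)
    then show ?thesis
      using l r r1 theta_bar_pure[OF r] theta_label[OF r, of \<alpha>s xs \<beta>] by (simp add: F_def G_def)
  qed
  then have "F fs = G fs"
    unfolding multilinear_expand[OF F len] multilinear_expand[OF G len] using len
    by (intro sum.cong refl) (auto simp: listset_iff dest!: list_all2_lengthD)
  then show ?thesis by (simp add: F_def G_def)
qed

text \<open>Both sides run over the same label lists with the same coefficients, and
  \<open>total\<close> drops the labels of the values. Facts about \<open>eta_tensor\<close> thus
  reduce to facts about \<open>theta_bar\<close>.\<close>

lemma eta_tensor_eq:
  assumes r: "marked_at r zs" and k: "length zs = k"
  shows "eta_tensor \<theta> k zs = total (theta_bar \<theta> k r (map embed zs))"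
proof -
  \<comment> \<open>These are the label sets of \<open>eta_tensor\<close>. At a zero module entry
    the set is larger than the support after \<open>embed\<close>, which
    \<open>theta_bar_superset\<close> permits.\<close>
  define As where "As = map (\<lambda>z :: ('w \<Rightarrow>\<^sub>0 'd) + 'd. case z of Inl f \<Rightarrow> Poly_Mapping.keys f | Inr x \<Rightarrow> {undefined}) zs"
  have r1: "r \<in> {1..k}" using r k by (simp add: marked_at_def)
  have As: "finite (As ! j) \<and> Poly_Mapping.keys (map embed zs ! j) \<subseteq> As ! j" if "j < k" for j
    using that k by (cases "zs ! j") (auto simp: As_def dest: subsetD[OF keys_pure_tensor])
  have args: "map2 (\<lambda>z \<alpha>. case z of Inl f \<Rightarrow> Poly_Mapping.lookup f \<alpha> | Inr x \<Rightarrow> x) zs \<alpha>s =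
      map2 Poly_Mapping.lookup (map embed zs) \<alpha>s" if "\<alpha>s \<in> listset As" for \<alpha>s
  proof (rule nth_equalityI)
    fix j assume j: "j < length (map2 (\<lambda>z \<alpha>. case z of Inl f \<Rightarrow> Poly_Mapping.lookup f \<alpha> | Inr x \<Rightarrow> x) zs \<alpha>s)"
    then have "\<alpha>s ! j \<in> As ! j" using that by (auto simp: listset_iff As_def list_all2_conv_all_nth)
    then show "map2 (\<lambda>z \<alpha>. case z of Inl f \<Rightarrow> Poly_Mapping.lookup f \<alpha> | Inr x \<Rightarrow> x) zs \<alpha>s ! j =
      map2 Poly_Mapping.lookup (map embed zs) \<alpha>s ! j"
      using j by (cases "zs ! j") (auto simp: As_def lookup_pure_tensor)
  qed simp
  have "theta_bar \<theta> k r (map embed zs) = (\<Sum>\<alpha>s\<in>listset As.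
    pure_tensor (\<theta> k r \<alpha>s (map2 Poly_Mapping.lookup (map embed zs) \<alpha>s)) (label_prod \<alpha>s))"
    using k As by (intro theta_bar_superset[OF r1]) (auto simp: As_def)
  then have "total (theta_bar \<theta> k r (map embed zs)) =
      (\<Sum>\<alpha>s\<in>listset As. \<theta> k r \<alpha>s (map2 Poly_Mapping.lookup (map embed zs) \<alpha>s))"
    by (simp add: total_sum)
  then show ?thesis
    unfolding eta_tensor_def Let_def length_takeWhile_marked[OF r] As_def[symmetric]
    by (simp add: args cong: sum.cong)
qed

lemma eta_tensor_pure:
  assumes r: "r \<in> {1..k}" and len: "length xs = k" "length \<alpha>s = k"
  shows "eta_tensor \<theta> k ((map2 (\<lambda>x \<alpha>. Inl (pure_tensor x \<alpha>)) xs \<alpha>s)[r - 1 := Inr (xs ! (r - 1))]) =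
    \<theta> k r \<alpha>s xs"
proof -
  let ?zs = "(map2 (\<lambda>x \<alpha>. Inl (pure_tensor x \<alpha>)) xs \<alpha>s)[r - 1 := Inr (xs ! (r - 1))]"
  have "marked_at r ?zs" using r len by (auto simp: marked_at_def nth_list_update)
  \<comment> \<open>Embedding replaces the \<open>r\<close>-th label by \<open>undefined\<close>;
    \<open>theta_label\<close> undoes this change.\<close>
  moreover have "map embed ?zs = map2 pure_tensor xs (\<alpha>s[r - 1 := undefined])"
    using r len by (intro nth_equalityI) (auto simp: nth_list_update)
  ultimately show ?thesis
    using r len theta_label[OF r len(2,1), of undefined] by (simp add: eta_tensor_eq theta_bar_pure)
qed

text \<open>The position of the module entry selects the branch of \<open>dend_comp\<close>: outside
  the block the inner operation is the sum \<open>mu_tensor\<close>, inside it is one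
  \<open>eta_tensor\<close>. The outer operation always acts on a marked list.\<close>

lemma mixed_op_insertion:
  assumes r: "marked_at r zs" and n: "length zs = n" and k: "k + l = n + 1" and i: "1 \<le> i" "i \<le> k" and l: "1 \<le> l"
  shows "projr (mixed_op (mu_tensor \<theta>) (eta_tensor \<theta>) k
      (contract i l zs (mixed_op (mu_tensor \<theta>) (eta_tensor \<theta>) l (block i l zs)))) =
    total (dend_comp (theta_bar \<theta>) k l i r (map embed zs))"
proof -
  let ?op = "mixed_op (mu_tensor \<theta>) (eta_tensor \<theta>)"
  have il: "i + l \<le> length zs + 1" using n k i by simp
  have outer: "projr (?op k (contract i l zs z)) =
      total (theta_bar \<theta> k q (contract i l (map embed zs) (embed z)))"
    if "q = (if r < i then r else if r < i + l then i else r - l + 1)" "isl z \<longleftrightarrow> r < i \<or> i + l \<le> r" for q z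
  proof -
    have "marked_at q (contract i l zs z)" using that by (intro marked_at_contract[OF r i(1) l il])
    moreover have "length (contract i l zs z) = k" using length_contract[OF i(1) il] n k by simp
    ultimately show ?thesis by (simp add: mixed_op_marked eta_tensor_eq map_contract)
  qed
  consider "r < i" | "i \<le> r" "r < i + l" | "i + l \<le> r" by linarith
  then show ?thesis
  proof cases
    case 1
    then show ?thesis
      using block_unmarked[OF r i(1) il] outer[of r]
      by (simp add: dend_comp_def mu_tensor_eq)
  next
    case 2
    let ?y = "theta_bar \<theta> l (r - i + 1) (block i l (map embed zs))"
    have "marked_at (r - i + 1) (block i l zs)" by (rule marked_at_block[OF r i(1) il 2])
    moreover have "length (block i l zs) = l" using i(1) il by (rule length_block)
    ultimately have "?op l (block i l zs) = Inr (total ?y)"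
      by (simp add: mixed_op_marked eta_tensor_eq map_block)
    then have "projr (?op k (contract i l zs (?op l (block i l zs)))) =
        total (theta_bar \<theta> k i (contract i l (map embed zs) (pure_tensor (total ?y) undefined)))"
      using 2 outer[of i "Inr (total ?y)"] by simp
    \<comment> \<open>The inner value has lost its labels and is reinserted with label
      \<open>undefined\<close>. The outer operation has index \<open>i\<close>, the very slot of
      insertion, so \<open>total_theta_bar_slot\<close> shows that its total is unchanged.\<close>
    also have "\<dots> = total (theta_bar \<theta> k i (contract i l (map embed zs) ?y))"
    proof -
      have il': "i + l \<le> length (map embed zs) + 1" using il by simp
      have "contract i l (map embed zs) ?y ! (i - 1) = ?y"
        using i l n k by (subst nth_contract) auto
      moreover have "length (contract i l (map embed zs) ?y) = k"
        using length_contract[OF i(1) il'] n k by simp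
      ultimately show ?thesis
        using total_theta_bar_slot[of i k "contract i l (map embed zs) ?y" undefined] i
        by (simp only: contract_update_slot[OF i(1) il']) simp
    qed
    finally show ?thesis using 2 by (simp add: dend_comp_def)
  next
    case 3
    then show ?thesis
      using block_unmarked[OF r i(1) il] outer[of "r - l + 1"] l
      by (simp add: dend_comp_def mu_tensor_eq)
  qed
qed

lemma mixed_multilinear_eta_tensor: "mixed_multilinear (tensor_scale s) s k (eta_tensor \<theta> k)"
  unfolding mixed_multilinear_def
proof (intro ballI allI impI)
  fix zs :: "(('w \<Rightarrow>\<^sub>0 'd) + 'd) list" and j assume zs: "zs \<in> mixed_tensors k" and j: "j < k"
  from zs obtain r where r: "marked_at r zs" and k: "length zs = k" by (rule marked_atE)
  have r1: "r \<in> {1..k}" using r k by (simp add: marked_at_def)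
  have eta: "eta_tensor \<theta> k (zs[j := z]) = total (theta_bar \<theta> k r ((map embed zs)[j := embed z]))"
    if "isl z = isl (zs ! j)" for z
    using marked_at_list_update[OF r _ that] j k by (simp add: eta_tensor_eq map_update)
  have lin: "Vector_Spaces.linear (tensor_scale s) s (\<lambda>f. total (theta_bar \<theta> k r ((map embed zs)[j := f])))"
    using k j by (intro linear_comp[OF theta_bar_linear linear_total] r1) auto
  show "if isl (zs ! j) then Vector_Spaces.linear (tensor_scale s) s (\<lambda>f. eta_tensor \<theta> k (zs[j := Inl f]))
     else Vector_Spaces.linear s s (\<lambda>u. eta_tensor \<theta> k (zs[j := Inr u]))"
    \<comment> \<open>For a module entry, the embedding as a pure tensor is one more linear map to
      precompose with.\<close>
    using lin linear_comp[OF linear_pure_tensor lin] by (simp add: eta)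
qed

lemma total_in_grading: "f \<in> tensor_grading D d \<Longrightarrow> total f \<in> D d"
  unfolding total_def by (intro subspace_sum subspace_grading) (simp add: tensor_grading_def)

lemma homogeneous_embed:
  fixes zs :: "(('w \<Rightarrow>\<^sub>0 'd) + 'd) list"
  assumes "homogeneous (mixed_grading (tensor_grading D) D) ds zs"
  shows "homogeneous (tensor_grading D) ds (map embed zs)"
  unfolding homogeneous_def list.rel_map(2)
proof (rule list.rel_mono_strong[OF assms[unfolded homogeneous_def]])
  fix d and z :: "('w \<Rightarrow>\<^sub>0 'd) + 'd" assume "z \<in> mixed_grading (tensor_grading D) D d"
  then show "embed z \<in> tensor_grading D d"
    by (auto simp: mixed_grading_def tensor_grading_def lookup_pure_tensor subspace_0[OF subspace_grading])
qed

text \<open>The position \<open>r\<close> of the module entry stays fixed throughout an identity, so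
  a single dendriform identity is involved; the linear, degree-preserving map \<open>total\<close>
  sends it to the module.\<close>

lemma ainf_representation_eta_tensor:
  "ainf_representation (tensor_scale s) (tensor_grading D) (mu_tensor \<theta>) s D (eta_tensor \<theta>)"
  unfolding ainf_representation_def
proof (intro conjI allI impI ballI ainf_algebra_mu_tensor graded mixed_multilinear_eta_tensor)
  fix k ds and zs :: "(('w \<Rightarrow>\<^sub>0 'd) + 'd) list"
  assume zs: "zs \<in> mixed_tensors k" and hom: "homogeneous (mixed_grading (tensor_grading D) D) ds zs"
  from zs obtain r where r: "marked_at r zs" and k: "length zs = k" by (rule marked_atE)
  have "r \<in> {1..k}" using r k by (simp add: marked_at_def)
  from theta_bar_degree[OF this] have "theta_bar \<theta> k r (map embed zs) \<in> tensor_grading D (sum_list ds + 1)"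
    using homogeneous_embed[OF hom] k by (simp add: degree_one_def)
  then show "eta_tensor \<theta> k zs \<in> D (sum_list ds + 1)"
    unfolding eta_tensor_eq[OF r k] by (rule total_in_grading)
next
  fix n ds and zs :: "(('w \<Rightarrow>\<^sub>0 'd) + 'd) list"
  assume zs: "zs \<in> mixed_tensors n" and hom: "homogeneous (mixed_grading (tensor_grading D) D) ds zs"
  from zs obtain r where r: "marked_at r zs" and n: "length zs = n" by (rule marked_atE)
  have r1: "r \<in> {1..n}" using r n by (simp add: marked_at_def)
  let ?op = "mixed_op (mu_tensor \<theta>) (eta_tensor \<theta>)"
  have comp: "projr (?op k (contract i (n + 1 - k) zs (?op (n + 1 - k) (block i (n + 1 - k) zs)))) =
      total (dend_comp (theta_bar \<theta>) k (n + 1 - k) i r (map embed zs))"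
    if "k \<in> {1..n}" "i \<in> {1..k}" for k i
    using that by (intro mixed_op_insertion[OF r n]) auto
  have "(\<Sum>k=1..n. \<Sum>i=1..k. s (insertion_sign i ds)
      (projr (?op k (contract i (n + 1 - k) zs (?op (n + 1 - k) (block i (n + 1 - k) zs)))))) =
    (\<Sum>k=1..n. \<Sum>i=1..k. s (insertion_sign i ds)
      (total (dend_comp (theta_bar \<theta>) k (n + 1 - k) i r (map embed zs))))"
    by (intro sum.cong refl) (simp only: comp)
  also have "\<dots> = total (\<Sum>k=1..n. \<Sum>i=1..k. tensor_scale s (insertion_sign i ds)
      (dend_comp (theta_bar \<theta>) k (n + 1 - k) i r (map embed zs)))"
    by (simp only: total_sum total_scale)
  also have "\<dots> = 0"
    using theta_bar_identity[OF r1 _ homogeneous_embed[OF hom]] n by (simp add: total_0)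
  finally show "(\<Sum>k=1..n. \<Sum>i=1..k. s (insertion_sign i ds)
      (projr (?op k (contract i (n + 1 - k) zs (?op (n + 1 - k) (block i (n + 1 - k) zs)))))) = 0" .
qed


section \<open>The relative Rota-Baxter family\<close>

lemma eta_tensor_rb_args:
  assumes "r \<in> {1..k}" "length \<alpha>s = k" "length us = k"
  shows "eta_tensor \<theta> k (rb_args (\<lambda>\<alpha> x. pure_tensor x \<alpha>) r \<alpha>s us) = \<theta> k r \<alpha>s us"
proof -
  have "map2 (\<lambda>\<alpha> u. Inl (pure_tensor u \<alpha>) :: ('w \<Rightarrow>\<^sub>0 'd) + 'd) \<alpha>s us =
      map2 (\<lambda>u \<alpha>. Inl (pure_tensor u \<alpha>)) us \<alpha>s"
    using assms by (intro nth_equalityI) auto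
  then show ?thesis unfolding rb_args_def using eta_tensor_pure[OF assms(1,3,2)] by (simp only:)
qed

text \<open>With x sent to x tensor \<alpha>, \<open>eta_tensor_rb_args\<close> turns the right-hand
  side of the Rota-Baxter relation into the formula for \<open>mu_tensor\<close> on pure
  tensors.\<close>

lemma strict_rel_rota_baxter_family_pure_tensor:
  "strict_rel_rota_baxter_family (tensor_scale s) (tensor_grading D) (mu_tensor \<theta>) s D (eta_tensor \<theta>)
    (\<lambda>\<alpha> x. pure_tensor x \<alpha>)"
  unfolding strict_rel_rota_baxter_family_def
proof (intro conjI allI impI ballI ainf_algebra_mu_tensor ainf_representation_eta_tensor linear_pure_tensor)
  show "pure_tensor u \<alpha> \<in> tensor_grading D d" if "u \<in> D d" for \<alpha> :: 'w and u d
    using that by (simp add: tensor_grading_def lookup_pure_tensor subspace_0[OF subspace_grading])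
next
  fix k and \<alpha>s :: "'w list" and us :: "'d list" assume len: "length \<alpha>s = k" "length us = k"
  have "map2 (\<lambda>\<alpha> u. pure_tensor u \<alpha>) \<alpha>s us = map2 pure_tensor us \<alpha>s"
    using len by (intro nth_equalityI) auto
  then show "mu_tensor \<theta> k (map2 (\<lambda>\<alpha> u. pure_tensor u \<alpha>) \<alpha>s us) =
      (\<Sum>r=1..k. pure_tensor (eta_tensor \<theta> k (rb_args (\<lambda>\<alpha> x. pure_tensor x \<alpha>) r \<alpha>s us)) (label_prod \<alpha>s))"
    using len by (simp add: mu_tensor_pure eta_tensor_rb_args)
qed

end

theorem theorem6p11:
  fixes scale :: "'k::field_char_0 \<Rightarrow> 'd::ab_group_add \<Rightarrow> 'd"
    and D :: "int \<Rightarrow> 'd set"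
    and \<theta> :: "nat \<Rightarrow> nat \<Rightarrow> 'w::semigroup_mult list \<Rightarrow> 'd list \<Rightarrow> 'd"
  assumes "dend_inf_family_algebra scale D \<theta>"
  shows
    "\<comment> \<open>(i)\<close>
     ((\<forall>k\<ge>1. \<forall>r\<in>{1..k}. \<forall>xs \<alpha>s. length xs = k \<longrightarrow> length \<alpha>s = k \<longrightarrow>
         theta_bar \<theta> k r (map2 pure_tensor xs \<alpha>s) = pure_tensor (\<theta> k r \<alpha>s xs) (label_prod \<alpha>s)) \<and>
      dend_inf_algebra (tensor_scale scale) (tensor_grading D) (theta_bar \<theta>)) \<and>
     \<comment> \<open>(ii)\<close>
     ((\<forall>k\<ge>1. \<forall>xs \<alpha>s. length xs = k \<longrightarrow> length \<alpha>s = k \<longrightarrow>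
         mu_tensor \<theta> k (map2 pure_tensor xs \<alpha>s) =
           (\<Sum>r=1..k. pure_tensor (\<theta> k r \<alpha>s xs) (label_prod \<alpha>s))) \<and>
      ainf_algebra (tensor_scale scale) (tensor_grading D) (mu_tensor \<theta>) \<and>
      (\<forall>k\<ge>1. \<forall>r\<in>{1..k}. \<forall>xs \<alpha>s. length xs = k \<longrightarrow> length \<alpha>s = k \<longrightarrow>
         eta_tensor \<theta> k ((map2 (\<lambda>x \<alpha>. Inl (pure_tensor x \<alpha>)) xs \<alpha>s)[r - 1 := Inr (xs ! (r - 1))]) =
           \<theta> k r \<alpha>s xs) \<and>
      ainf_representation (tensor_scale scale) (tensor_grading D) (mu_tensor \<theta>)
        scale D (eta_tensor \<theta>)) \<and>
     \<comment> \<open>(iii)\<close>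
     (strict_rel_rota_baxter_family (tensor_scale scale) (tensor_grading D) (mu_tensor \<theta>)
        scale D (eta_tensor \<theta>) (\<lambda>\<alpha> x. pure_tensor x \<alpha>) \<and>
      (\<forall>k\<ge>1. \<forall>r\<in>{1..k}. \<forall>\<alpha>s us. length \<alpha>s = k \<longrightarrow> length us = k \<longrightarrow>
         induced_dend_family (eta_tensor \<theta>) (\<lambda>\<alpha> x. pure_tensor x \<alpha>) k r \<alpha>s us = \<theta> k r \<alpha>s us))"
proof -
  interpret dend_inf_family scale D \<theta> by unfold_locales (rule assms)
  show ?thesis
    unfolding induced_dend_family_def
    by (intro conjI allI impI ballI theta_bar_pure dend_inf_algebra_theta_bar mu_tensor_pure
        ainf_algebra_mu_tensor eta_tensor_pure ainf_representation_eta_tensor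
        strict_rel_rota_baxter_family_pure_tensor eta_tensor_rb_args)
qed

end
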